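(* For $i=1,2$ let $\eta_i:\mathbb{D}\to\mathbb{D}$ be a continuous map which is analytic on the interior of $\mathbb{D}$. Assume further that $\eta_1$ is not elliptic. Then the semicrossed products $A(\mathbb{D})\times_{\eta_1}\mathbb{Z}^+$ and $A(\mathbb{D})\times_{\eta_2}\mathbb{Z}^+$ are isomorphic as algebras if and only if there exists a homeomorphism $\gamma_s:\mathbb{D}\to\mathbb{D}$ which is analytic in the interior and satisfies $\gamma_s\circ\eta_1=\eta_2\circ\gamma_s$.
   Context: $\mathbb{D}$ is the closed unit disc in $\mathbb{C}$ and $A(\mathbb{D})$ the disc algebra (functions continuous on $\mathbb{D}$ and analytic on its interior). A continuous map $\eta:\mathbb{D}\to\mathbb{D}$ which is analytic on the interior is called elliptic if $\eta$ has exactly one fixed point which is located in the interior of $\mathbb{D}$. "Isomorphic as algebras" means there is a bijective complex algebra homomorphism; no continuity is assumed. Semicrossed product: for $x\in\mathbb{D}$ let $\mathcal{H}_x=\ell^2(\mathbb{N})$ be the space of square summable sequences $\xi=(\xi_n)_{n=0}^\infty$, and put $\pi_x(f)\xi=(f(x)\xi_0,(f\circ\eta)(x)\xi_1,(f\circ\eta^{(2)})(x)\xi_2,\dots)$ for $f\in A(\mathbb{D})$, where $\eta^{(n)}$ is the $n$-fold composition, and $U_x\xi=(0,\xi_0,\xi_1,\dots)$ (forward shift). Then $A(\mathbb{D})\times_\eta\mathbb{Z}^+$ is the norm closed operator algebra acting on $\bigoplus_{x\in\mathbb{D}}\mathcal{H}_x$ generated by the operators $\bigoplus_{x\in\mathbb{D}}\pi_x(f)$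 and $\bigoplus_{x\in\mathbb{D}}U_x\pi_x(g)$, $f,g\in A(\mathbb{D})$. *)

theory Defs
  imports "HOL-Complex_Analysis.Complex_Analysis"
begin

section \<open>Complex scalars on real inner product spaces\<close>

text \<open>
  The norm of a complex Hilbert space is the norm of its underlying real inner product
  \<open>Re \<langle>x, y\<rangle>\<close>. The complex structure is recorded by a compatible multiplication by complex
  scalars.
\<close>

class complex_scalars = real_inner +
  fixes cscale :: "complex \<Rightarrow> 'a \<Rightarrow> 'a"  (infixr "*\<^sub>C" 75)
  assumes cscale_add_right: "c *\<^sub>C (x + y) = c *\<^sub>C x + c *\<^sub>C y"
    and cscale_add_left: "(c + d) *\<^sub>C x = c *\<^sub>C x + d *\<^sub>C x"
    and cscale_cscale: "c *\<^sub>C d *\<^sub>C x = (c * d) *\<^sub>C x"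
    and cscale_of_real: "of_real r *\<^sub>C x = r *\<^sub>R x"
    and norm_cscale: "norm (c *\<^sub>C x) = cmod c * norm x"

instantiation complex :: complex_scalars
begin

definition cscale_complex :: "complex \<Rightarrow> complex \<Rightarrow> complex"
  where "cscale_complex = (*)"

instance
  by standard (auto simp: cscale_complex_def algebra_simps norm_mult scaleR_conv_of_real)

end

lemma cscale_scaleR: "c *\<^sub>C (r *\<^sub>R x) = r *\<^sub>R (c *\<^sub>C x)"
  by (metis cscale_cscale cscale_of_real mult.commute)

lemma bounded_linear_cscale: "bounded_linear (cscale c :: 'a::complex_scalars \<Rightarrow> 'a)"
  by (rule bounded_linear_intro[where K = "cmod c"])
    (auto simp: cscale_add_right cscale_scaleR norm_cscale mult.commute)


section \<open>Hilbert sums\<close>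

text \<open>
  The Hilbert sum of copies of \<open>'a\<close> indexed by \<open>'i\<close>. Both \<open>\<ell>\<^sup>2(\<nat>)\<close> and the sum of the spaces
  \<open>\<H>\<^sub>x\<close>, which all are equal to \<open>\<ell>\<^sup>2(\<nat>)\<close>, are instances.
\<close>

typedef (overloaded) ('i, 'a::real_inner) hilbert_sum =
  "{\<xi> :: 'i \<Rightarrow> 'a. (\<lambda>i. (norm (\<xi> i))\<^sup>2) summable_on UNIV}"
  morphisms coord of_coords
  by (rule exI[of _ "\<lambda>_. 0"]) simp

setup_lifting type_definition_hilbert_sum

lemma square_summable_add:
  fixes f g :: "'i \<Rightarrow> 'a::real_inner"
  assumes "(\<lambda>i. (norm (f i))\<^sup>2) summable_on UNIV" "(\<lambda>i. (norm (g i))\<^sup>2) summable_on UNIV"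
  shows "(\<lambda>i. (norm (f i + g i))\<^sup>2) summable_on UNIV"
proof (rule summable_on_comparison_test)
  show "(\<lambda>i. 2 * (norm (f i))\<^sup>2 + 2 * (norm (g i))\<^sup>2) summable_on UNIV"
    by (intro summable_on_add summable_on_cmult_right assms)
  fix i
  have "(norm (f i + g i))\<^sup>2 \<le> (norm (f i) + norm (g i))\<^sup>2"
    by (intro power_mono norm_triangle_ineq norm_ge_zero)
  also have "\<dots> \<le> 2 * (norm (f i))\<^sup>2 + 2 * (norm (g i))\<^sup>2"
    using sum_squares_bound[of "norm (f i)" "norm (g i)"] by (simp add: power2_sum)
  finally show "(norm (f i + g i))\<^sup>2 \<le> 2 * (norm (f i))\<^sup>2 + 2 * (norm (g i))\<^sup>2" .
qed simp

lemma square_summable_bounded: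
  fixes f :: "'i \<Rightarrow> 'a::real_inner" and g :: "'i \<Rightarrow> 'b::real_inner"
  assumes "(\<lambda>i. (norm (f i))\<^sup>2) summable_on UNIV" "\<And>i. norm (g i) \<le> K * norm (f i)"
  shows "(\<lambda>i. (norm (g i))\<^sup>2) summable_on UNIV"
proof (rule summable_on_comparison_test)
  show "(\<lambda>i. K\<^sup>2 * (norm (f i))\<^sup>2) summable_on UNIV"
    by (intro summable_on_cmult_right assms)
  show "(norm (g i))\<^sup>2 \<le> K\<^sup>2 * (norm (f i))\<^sup>2" for i
    using power_mono[OF assms(2)[of i] norm_ge_zero, of 2] by (simp add: power_mult_distrib)
qed simp

lemma inner_summable:
  fixes f g :: "'i \<Rightarrow> 'a::real_inner"
  assumes "(\<lambda>i. (norm (f i))\<^sup>2) summable_on UNIV" "(\<lambda>i. (norm (g i))\<^sup>2) summable_on UNIV"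
  shows "(\<lambda>i. f i \<bullet> g i) summable_on UNIV"
proof (rule abs_summable_summable, rule summable_on_comparison_test)
  show "(\<lambda>i. (norm (f i))\<^sup>2 + (norm (g i))\<^sup>2) summable_on UNIV"
    by (intro summable_on_add assms)
  fix i
  have "\<bar>f i \<bullet> g i\<bar> \<le> norm (f i) * norm (g i)"
    by (rule Cauchy_Schwarz_ineq2)
  also have "\<dots> \<le> 2 * norm (f i) * norm (g i)"
    by simp
  also have "\<dots> \<le> (norm (f i))\<^sup>2 + (norm (g i))\<^sup>2"
    by (rule sum_squares_bound)
  finally show "norm (f i \<bullet> g i) \<le> (norm (f i))\<^sup>2 + (norm (g i))\<^sup>2"
    by simp
qed simp

instantiation hilbert_sum :: (type, real_inner) real_inner
begin

lift_definition zero_hilbert_sum :: "('a, 'b) hilbert_sum" is "\<lambda>_. 0"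
  by simp

lift_definition plus_hilbert_sum ::
  "('a, 'b) hilbert_sum \<Rightarrow> ('a, 'b) hilbert_sum \<Rightarrow> ('a, 'b) hilbert_sum"
  is "\<lambda>\<xi> \<zeta> i. \<xi> i + \<zeta> i"
  by (rule square_summable_add)

lift_definition uminus_hilbert_sum :: "('a, 'b) hilbert_sum \<Rightarrow> ('a, 'b) hilbert_sum"
  is "\<lambda>\<xi> i. - \<xi> i"
  by simp

lift_definition minus_hilbert_sum ::
  "('a, 'b) hilbert_sum \<Rightarrow> ('a, 'b) hilbert_sum \<Rightarrow> ('a, 'b) hilbert_sum"
  is "\<lambda>\<xi> \<zeta> i. \<xi> i - \<zeta> i"
  using square_summable_add[where g = "\<lambda>i. - _ i"] by fastforce

lift_definition scaleR_hilbert_sum ::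
  "real \<Rightarrow> ('a, 'b) hilbert_sum \<Rightarrow> ('a, 'b) hilbert_sum"
  is "\<lambda>r \<xi> i. r *\<^sub>R \<xi> i"
  by (simp add: power_mult_distrib summable_on_cmult_right)

lift_definition inner_hilbert_sum ::
  "('a, 'b) hilbert_sum \<Rightarrow> ('a, 'b) hilbert_sum \<Rightarrow> real"
  is "\<lambda>\<xi> \<zeta>. \<Sum>\<^sub>\<infinity>i. \<xi> i \<bullet> \<zeta> i" .

definition norm_hilbert_sum :: "('a, 'b) hilbert_sum \<Rightarrow> real"
  where "norm_hilbert_sum \<xi> = sqrt (\<xi> \<bullet> \<xi>)"

definition sgn_hilbert_sum :: "('a, 'b) hilbert_sum \<Rightarrow> ('a, 'b) hilbert_sum"
  where "sgn_hilbert_sum \<xi> = inverse (norm \<xi>) *\<^sub>R \<xi>"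

definition dist_hilbert_sum :: "('a, 'b) hilbert_sum \<Rightarrow> ('a, 'b) hilbert_sum \<Rightarrow> real"
  where "dist_hilbert_sum \<xi> \<zeta> = norm (\<xi> - \<zeta>)"

definition uniformity_hilbert_sum ::
    "(('a, 'b) hilbert_sum \<times> ('a, 'b) hilbert_sum) filter"
  where "uniformity_hilbert_sum = (INF e\<in>{0 <..}. principal {(\<xi>, \<zeta>). dist \<xi> \<zeta> < e})"

definition open_hilbert_sum :: "('a, 'b) hilbert_sum set \<Rightarrow> bool"
  where "open_hilbert_sum U \<longleftrightarrow> (\<forall>\<xi>\<in>U. \<forall>\<^sub>F (\<xi>', \<zeta>) in uniformity. \<xi>' = \<xi> \<longrightarrow> \<zeta> \<in> U)"

instance
proof
  fix x y z :: "('a, 'b) hilbert_sum" and r s :: real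
  show "x + y + z = x + (y + z)" "x + y = y + x" "0 + x = x" "- x + x = 0" "x - y = x + - y"
    "r *\<^sub>R (x + y) = r *\<^sub>R x + r *\<^sub>R y" "(r + s) *\<^sub>R x = r *\<^sub>R x + s *\<^sub>R x"
    "r *\<^sub>R s *\<^sub>R x = (r * s) *\<^sub>R x" "1 *\<^sub>R x = x"
    by (transfer; simp add: algebra_simps)+
  show "sgn x = inverse (norm x) *\<^sub>R x" "dist x y = norm (x - y)" "norm x = sqrt (x \<bullet> x)"
    by (fact sgn_hilbert_sum_def dist_hilbert_sum_def norm_hilbert_sum_def)+
  show "(uniformity :: (('a, 'b) hilbert_sum \<times> ('a, 'b) hilbert_sum) filter) =
      (INF e\<in>{0 <..}. principal {(\<xi>, \<zeta>). dist \<xi> \<zeta> < e})"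
    by (fact uniformity_hilbert_sum_def)
  show "open U = (\<forall>\<xi>\<in>U. \<forall>\<^sub>F (\<xi>', \<zeta>) in uniformity. \<xi>' = \<xi> \<longrightarrow> \<zeta> \<in> U)"
    for U :: "('a, 'b) hilbert_sum set"
    by (fact open_hilbert_sum_def)
  show "x \<bullet> y = y \<bullet> x"
    by transfer (simp add: inner_commute)
  show "(x + y) \<bullet> z = x \<bullet> z + y \<bullet> z"
    by transfer (simp add: inner_add_left infsum_add inner_summable)
  show "r *\<^sub>R x \<bullet> y = r * (x \<bullet> y)"
    by transfer (simp add: infsum_cmult_right')
  show "0 \<le> x \<bullet> x"
    by transfer (simp add: infsum_nonneg)
  show "x \<bullet> x = 0 \<longleftrightarrow> x = 0"
  proof
    show "x \<bullet> x = 0 \<Longrightarrow> x = 0"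
    proof transfer
      fix \<xi> :: "'a \<Rightarrow> 'b"
      assume *: "(\<lambda>i. (norm (\<xi> i))\<^sup>2) summable_on UNIV" "(\<Sum>\<^sub>\<infinity>i. \<xi> i \<bullet> \<xi> i) = 0"
      have "\<xi> i \<bullet> \<xi> i = 0" for i
        by (rule nonneg_infsum_le_0D[of "\<lambda>i. \<xi> i \<bullet> \<xi> i" UNIV])
          (use * inner_summable[OF *(1) *(1)] in auto)
      then show "\<xi> = (\<lambda>_. 0)"
        by auto
    qed
  qed (transfer, simp)
qed

end

instantiation hilbert_sum :: (type, complex_scalars) complex_scalars
begin

lift_definition cscale_hilbert_sum ::
  "complex \<Rightarrow> ('a, 'b) hilbert_sum \<Rightarrow> ('a, 'b) hilbert_sum"
  is "\<lambda>c \<xi> i. c *\<^sub>C \<xi> i"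
  by (simp add: norm_cscale power_mult_distrib summable_on_cmult_right)

instance
proof
  fix x y :: "('a, 'b) hilbert_sum" and c d :: complex and r :: real
  show "c *\<^sub>C (x + y) = c *\<^sub>C x + c *\<^sub>C y" "(c + d) *\<^sub>C x = c *\<^sub>C x + d *\<^sub>C x"
    "c *\<^sub>C d *\<^sub>C x = (c * d) *\<^sub>C x" "of_real r *\<^sub>C x = r *\<^sub>R x"
    by (transfer; simp add: cscale_add_right cscale_add_left cscale_cscale cscale_of_real)+
  have "c *\<^sub>C x \<bullet> c *\<^sub>C x = (cmod c)\<^sup>2 * (x \<bullet> x)"
    by transfer (simp add: dot_square_norm norm_cscale power_mult_distrib infsum_cmult_right')
  then show "norm (c *\<^sub>C x) = cmod c * norm x"
    by (simp add: norm_eq_sqrt_inner real_sqrt_mult)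
qed

end

lemma norm_hilbert_sum_square: "(norm \<xi>)\<^sup>2 = (\<Sum>\<^sub>\<infinity>i. (norm (coord \<xi> i))\<^sup>2)"
  by (simp add: power2_norm_eq_inner inner_hilbert_sum.rep_eq)

lemma coord_summable: "(\<lambda>i. (norm (coord \<xi> i))\<^sup>2) summable_on UNIV"
  using coord[of \<xi>] by simp

text \<open>
  The direct sum of operators; it is the intended one whenever the norms of the summands are
  bounded, as \<open>Blinfun\<close> is unspecified on maps that are not bounded linear.
\<close>

definition oplus :: "('i \<Rightarrow> 'a \<Rightarrow>\<^sub>L 'b) \<Rightarrow>
    ('i, 'a::real_inner) hilbert_sum \<Rightarrow>\<^sub>L ('i, 'b::real_inner) hilbert_sum"
  where "oplus T = Blinfun (\<lambda>\<xi>. of_coords (\<lambda>i. T i (coord \<xi> i)))"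

lemma coord_of_coords_bounded:
  fixes T :: "'i \<Rightarrow> 'a::real_inner \<Rightarrow> 'b::real_inner"
  assumes "\<And>i v. norm (T i v) \<le> K * norm v"
  shows "coord (of_coords (\<lambda>i. T i (coord \<xi> i))) i = T i (coord \<xi> i)"
  using square_summable_bounded[OF coord_summable[of \<xi>], where g = "\<lambda>i. T i (coord \<xi> i)"] assms
  by (subst of_coords_inverse) auto

lemma bounded_linear_of_coords:
  fixes T :: "'i \<Rightarrow> 'a::real_inner \<Rightarrow> 'b::real_inner"
  assumes lin: "\<And>i. linear (T i)" and bd: "\<And>i v. norm (T i v) \<le> K * norm v"
  shows "bounded_linear (\<lambda>\<xi>. of_coords (\<lambda>i. T i (coord \<xi> i)))" (is "bounded_linear ?F")
proof (rule bounded_linear_intro[where K = "\<bar>K\<bar>"])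
  note c = coord_of_coords_bounded[of T K, OF bd]
  show "?F (x + y) = ?F x + ?F y" for x y
    by (rule coord_inject[THEN iffD1], rule ext, simp only: c)
      (simp add: plus_hilbert_sum.rep_eq c linear_add[OF lin])
  show "?F (r *\<^sub>R x) = r *\<^sub>R ?F x" for r x
    by (rule coord_inject[THEN iffD1], rule ext, simp only: c)
      (simp add: scaleR_hilbert_sum.rep_eq c linear_scale[OF lin])
  show "norm (?F x) \<le> norm x * \<bar>K\<bar>" for x
  proof (rule power2_le_imp_le)
    have "(norm (?F x))\<^sup>2 \<le> (\<Sum>\<^sub>\<infinity>i. K\<^sup>2 * (norm (coord x i))\<^sup>2)"
      unfolding norm_hilbert_sum_square
    proof (rule infsum_mono)
      show "(norm (coord (?F x) i))\<^sup>2 \<le> K\<^sup>2 * (norm (coord x i))\<^sup>2" for i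
        using power_mono[OF bd norm_ge_zero, where n = 2] by (simp add: c power_mult_distrib)
    qed (intro coord_summable summable_on_cmult_right)+
    also have "\<dots> = (norm x * \<bar>K\<bar>)\<^sup>2"
      by (simp add: infsum_cmult_right' norm_hilbert_sum_square power_mult_distrib)
    finally show "(norm (?F x))\<^sup>2 \<le> (norm x * \<bar>K\<bar>)\<^sup>2" .
  qed simp
qed

lemma coord_oplus:
  assumes "\<And>i. norm (T i) \<le> K"
  shows "coord (oplus T \<xi>) i = T i (coord \<xi> i)"
proof -
  have bd: "norm (T i v) \<le> K * norm v" for i v
    by (meson assms mult_right_mono norm_blinfun norm_ge_zero order_trans)
  have "bounded_linear (\<lambda>\<xi>. of_coords (\<lambda>i. T i (coord \<xi> i)))"
    by (rule bounded_linear_of_coords[OF _ bd])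
      (simp add: blinfun.bounded_linear_right bounded_linear.linear)
  then show ?thesis
    by (simp add: oplus_def bounded_linear_Blinfun_apply coord_of_coords_bounded[of "\<lambda>i. T i", OF bd])
qed


section \<open>Norm closed operator algebras\<close>

lift_definition cscale_op :: "complex \<Rightarrow> ('a \<Rightarrow>\<^sub>L 'b) \<Rightarrow> 'a::real_normed_vector \<Rightarrow>\<^sub>L 'b::complex_scalars"
  is "\<lambda>c T v. c *\<^sub>C T v"
  by (rule bounded_linear_compose[OF bounded_linear_cscale])

definition operator_algebra :: "('a::complex_scalars \<Rightarrow>\<^sub>L 'a) set \<Rightarrow> bool"
  where "operator_algebra A \<longleftrightarrow> 0 \<in> A \<and>
    (\<forall>S\<in>A. \<forall>T\<in>A. S + T \<in> A \<and> S o\<^sub>L T \<in> A) \<and> (\<forall>c. \<forall>T\<in>A. cscale_op c T \<in> A)"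

definition norm_closed_algebra :: "('a::complex_scalars \<Rightarrow>\<^sub>L 'a) set \<Rightarrow> bool"
  where "norm_closed_algebra A \<longleftrightarrow> operator_algebra A \<and> closed A"

lemma norm_closed_algebra_hull: "norm_closed_algebra (norm_closed_algebra hull G)"
  by (rule hull_in) (auto simp: norm_closed_algebra_def operator_algebra_def)

text \<open>Isomorphisms of complex algebras; continuity is not required.\<close>

definition isomorphic_algebras ::
    "('a::complex_scalars \<Rightarrow>\<^sub>L 'a) set \<Rightarrow> ('b::complex_scalars \<Rightarrow>\<^sub>L 'b) set \<Rightarrow> bool"
  where "isomorphic_algebras A B \<longleftrightarrow> (\<exists>\<phi>. bij_betw \<phi> A B \<and>
    (\<forall>S\<in>A. \<forall>T\<in>A. \<phi> (S + T) = \<phi> S + \<phi> T \<and> \<phi> (S o\<^sub>L T) = \<phi> S o\<^sub>L \<phi> T) \<and>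
    (\<forall>c. \<forall>T\<in>A. \<phi> (cscale_op c T) = cscale_op c (\<phi> T)))"


section \<open>Semicrossed products of the disc algebra\<close>

definition disc_algebra :: "(complex \<Rightarrow> complex) set"
  where "disc_algebra = {f. continuous_on (cball 0 1) f \<and> f holomorphic_on ball 0 1}"

definition disc_map :: "(complex \<Rightarrow> complex) \<Rightarrow> bool"
  where "disc_map \<eta> \<longleftrightarrow> \<eta> \<in> disc_algebra \<and> \<eta> ` cball 0 1 \<subseteq> cball 0 1"

text \<open>The single fixed point in the closed disc lies in the open disc.\<close>

definition elliptic :: "(complex \<Rightarrow> complex) \<Rightarrow> bool"
  where "elliptic \<eta> \<longleftrightarrow> (\<exists>z\<in>ball 0 1. {w \<in> cball 0 1. \<eta> w = w} = {z})"

typedef disc = "cball (0::complex) 1"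
  morphisms of_disc to_disc
  by (rule exI[of _ 0]) simp

type_synonym l2 = "(nat, complex) hilbert_sum"

text \<open>
  The operators \<open>\<pi>\<^sub>x(f)\<close> and \<open>U\<^sub>x\<close>. The latter does not depend on \<open>x\<close>, as all \<open>\<H>\<^sub>x\<close> are equal.
\<close>

definition orbit_rep :: "(complex \<Rightarrow> complex) \<Rightarrow> disc \<Rightarrow> (complex \<Rightarrow> complex) \<Rightarrow> l2 \<Rightarrow>\<^sub>L l2"
  where "orbit_rep \<eta> x f =
    Blinfun (\<lambda>\<xi>. of_coords (\<lambda>n. f ((\<eta> ^^ n) (of_disc x)) * coord \<xi> n))"

definition shift :: "l2 \<Rightarrow>\<^sub>L l2"
  where "shift = Blinfun (\<lambda>\<xi>. of_coords (case_nat 0 (coord \<xi>)))"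

definition semicrossed_product ::
    "(complex \<Rightarrow> complex) \<Rightarrow> ((disc, l2) hilbert_sum \<Rightarrow>\<^sub>L (disc, l2) hilbert_sum) set"
  where "semicrossed_product \<eta> = norm_closed_algebra hull
    ({oplus (\<lambda>x. orbit_rep \<eta> x f) | f. f \<in> disc_algebra} \<union>
     {oplus (\<lambda>x. shift o\<^sub>L orbit_rep \<eta> x g) | g. g \<in> disc_algebra})"

text \<open>The operators above are bounded, and hence are given by the expected formulas.\<close>

lemma disc_algebra_bounded:
  assumes "f \<in> disc_algebra"
  obtains K where "0 \<le> K" "\<And>z. z \<in> cball 0 1 \<Longrightarrow> cmod (f z) \<le> K"
proof -
  have "bounded (f ` cball 0 1)"
    using assms by (intro compact_imp_bounded compact_continuous_image) (auto simp: disc_algebra_def)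
  then obtain K where "\<forall>z\<in>cball 0 1. cmod (f z) \<le> K"
    by (auto simp: bounded_iff)
  then show ?thesis
    using that[of "\<bar>K\<bar>"] by fastforce
qed

lemma funpow_disc_map:
  assumes "disc_map \<eta>"
  shows "(\<eta> ^^ n) (of_disc x) \<in> cball 0 1"
  using assms of_disc[of x] by (induction n) (auto simp: disc_map_def image_subset_iff)

lemma orbit_rep_bounded:
  assumes "disc_map \<eta>" and K: "0 \<le> K" "\<And>z. z \<in> cball 0 1 \<Longrightarrow> cmod (f z) \<le> K"
  shows "coord (orbit_rep \<eta> x f \<xi>) n = f ((\<eta> ^^ n) (of_disc x)) * coord \<xi> n"
    and "norm (orbit_rep \<eta> x f) \<le> K"
proof -
  define T where "T n v = f ((\<eta> ^^ n) (of_disc x)) * v" for n v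
  have bd: "norm (T n v) \<le> K * norm v" for n v
    using K funpow_disc_map[OF assms(1), of n x] unfolding T_def norm_mult
    by (intro mult_right_mono) auto
  have lin: "linear (T n)" for n
    unfolding T_def by (simp add: bounded_linear.linear bounded_linear_mult_right)
  have eq: "orbit_rep \<eta> x f \<xi> = of_coords (\<lambda>n. T n (coord \<xi> n))" for \<xi>
    using bounded_linear_Blinfun_apply[OF bounded_linear_of_coords[of T K, OF lin bd]]
    by (simp add: orbit_rep_def T_def)
  have c: "coord (orbit_rep \<eta> x f \<xi>) n = T n (coord \<xi> n)" for \<xi> n
    unfolding eq by (rule coord_of_coords_bounded[OF bd])
  then show "coord (orbit_rep \<eta> x f \<xi>) n = f ((\<eta> ^^ n) (of_disc x)) * coord \<xi> n"
    by (simp add: T_def)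
  show "norm (orbit_rep \<eta> x f) \<le> K"
  proof (rule norm_blinfun_bound[OF K(1)], rule power2_le_imp_le)
    fix \<xi>
    have "(norm (orbit_rep \<eta> x f \<xi>))\<^sup>2 \<le> (\<Sum>\<^sub>\<infinity>n. K\<^sup>2 * (norm (coord \<xi> n))\<^sup>2)"
      unfolding norm_hilbert_sum_square
    proof (rule infsum_mono)
      show "(norm (coord (orbit_rep \<eta> x f \<xi>) n))\<^sup>2 \<le> K\<^sup>2 * (norm (coord \<xi> n))\<^sup>2" for n
        using power_mono[OF bd norm_ge_zero, where n = 2] by (simp add: c power_mult_distrib)
    qed (intro coord_summable summable_on_cmult_right)+
    also have "\<dots> = (K * norm \<xi>)\<^sup>2"
      by (simp add: infsum_cmult_right' norm_hilbert_sum_square power_mult_distrib)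
    finally show "(norm (orbit_rep \<eta> x f \<xi>))\<^sup>2 \<le> (K * norm \<xi>)\<^sup>2" .
  qed (simp add: K)
qed

lemma shift_isometry: "coord (shift \<xi>) = case_nat 0 (coord \<xi>)" "norm (shift \<xi>) = norm \<xi>"
proof -
  have hs: "((\<lambda>n. (norm (case_nat 0 (coord \<zeta>) n :: complex))\<^sup>2) has_sum (norm \<zeta>)\<^sup>2) UNIV"
    for \<zeta> :: l2
  proof -
    have "((\<lambda>n. (norm (coord \<zeta> n))\<^sup>2) has_sum (norm \<zeta>)\<^sup>2) UNIV"
      unfolding norm_hilbert_sum_square by (rule has_sum_infsum[OF coord_summable])
    then have "((\<lambda>n. (norm (case_nat 0 (coord \<zeta>) n :: complex))\<^sup>2) has_sum (norm \<zeta>)\<^sup>2) (range Suc)"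
      by (subst has_sum_reindex) (auto simp: o_def)
    then show ?thesis
      by (rule has_sum_cong_neutral[THEN iffD1, rotated -1]) (auto split: nat.splits)
  qed
  have c: "coord (of_coords (case_nat 0 (coord \<zeta>))) = case_nat 0 (coord \<zeta>)" for \<zeta> :: l2
    using has_sum_imp_summable[OF hs[of \<zeta>]] by (subst of_coords_inverse) auto
  have n: "norm (of_coords (case_nat 0 (coord \<zeta>))) = norm \<zeta>" for \<zeta> :: l2
    using infsumI[OF hs[of \<zeta>]] norm_hilbert_sum_square[of "of_coords (case_nat 0 (coord \<zeta>))"]
    by (simp add: c)
  have "of_coords (case_nat 0 (coord (\<xi> + \<zeta>))) =
      of_coords (case_nat 0 (coord \<xi>)) + of_coords (case_nat 0 (coord \<zeta>))"
    "of_coords (case_nat 0 (coord (r *\<^sub>R \<xi>))) = r *\<^sub>R of_coords (case_nat 0 (coord \<xi>))"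
    for \<xi> \<zeta> :: l2 and r
    by (rule coord_inject[THEN iffD1], rule ext, simp only: c,
        simp add: plus_hilbert_sum.rep_eq scaleR_hilbert_sum.rep_eq c split: nat.splits)+
  then have "bounded_linear (\<lambda>\<xi>::l2. of_coords (case_nat 0 (coord \<xi>)))"
    by (rule bounded_linear_intro[where K = 1]) (simp add: n)
  then have "shift \<zeta> = of_coords (case_nat 0 (coord \<zeta>))" for \<zeta>
    by (simp add: shift_def bounded_linear_Blinfun_apply)
  then show "coord (shift \<xi>) = case_nat 0 (coord \<xi>)" "norm (shift \<xi>) = norm \<xi>"
    by (simp_all add: c n)
qed

lemma coord_semicrossed_generators:
  assumes "disc_map \<eta>" "f \<in> disc_algebra"
  shows "coord (coord (oplus (\<lambda>x. orbit_rep \<eta> x f) \<xi>) x) n =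
      f ((\<eta> ^^ n) (of_disc x)) * coord (coord \<xi> x) n"
    and "coord (coord (oplus (\<lambda>x. shift o\<^sub>L orbit_rep \<eta> x f) \<xi>) x) n =
      (case n of 0 \<Rightarrow> 0 | Suc m \<Rightarrow> f ((\<eta> ^^ m) (of_disc x)) * coord (coord \<xi> x) m)"
proof -
  obtain K where K: "0 \<le> K" "\<And>z. z \<in> cball 0 1 \<Longrightarrow> cmod (f z) \<le> K"
    using disc_algebra_bounded[OF assms(2)] by blast
  note r = orbit_rep_bounded[OF assms(1) K]
  have "norm (shift o\<^sub>L orbit_rep \<eta> y f) \<le> K" for y
    by (rule norm_blinfun_bound[OF K(1)])
      (auto simp: shift_isometry intro!: order_trans[OF norm_blinfun] mult_right_mono r(2))
  then show "coord (coord (oplus (\<lambda>x. orbit_rep \<eta> x f) \<xi>) x) n =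
      f ((\<eta> ^^ n) (of_disc x)) * coord (coord \<xi> x) n"
    "coord (coord (oplus (\<lambda>x. shift o\<^sub>L orbit_rep \<eta> x f) \<xi>) x) n =
      (case n of 0 \<Rightarrow> 0 | Suc m \<Rightarrow> f ((\<eta> ^^ m) (of_disc x)) * coord (coord \<xi> x) m)"
    using r by (auto simp: coord_oplus[where K = K] shift_isometry split: nat.splits)
qed

end

theory Submission
  imports Defs
begin

text \<open>
  Every element of \<open>A(D) \<times>\<^sub>\<eta> \<int>\<^sup>+\<close> is of the form \<open>f + U b\<close>, where \<open>f U = U (f \<circ> \<eta>)\<close>, and its characters
  are continuous. They form a disc on which \<open>U\<close> vanishes, and a further disc, with \<open>U\<close> as parameter,
  through each fixed point of \<open>\<eta>\<close>. An isomorphism induces a bijection of the characters that is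
  analytic on these discs. Unless \<open>\<eta>\<close> is the identity, in which case the algebra is commutative, the
  bijection can exchange the first disc with another one only if both meet in an interior point and
  there are no other fixed points; for \<open>\<eta>\<^sub>1\<close> not elliptic this is impossible. Hence the ideals generated
  by \<open>U\<close> correspond to each other, the bijection restricts to a biholomorphic map of the first discs,
  and the relation \<open>f U = U (f \<circ> \<eta>)\<close>, taken modulo the square of the ideal, shows that this map
  intertwines \<open>\<eta>\<^sub>1\<close> and \<open>\<eta>\<^sub>2\<close>.
\<close>

section \<open>Completeness of Hilbert sums\<close>

text \<open>An isomorphism is only algebraic, so all analysis has to be recovered from the
  characters. Completeness of the Hilbert sums makes every norm closed algebra complete, which
  forces characters to be contractive; a character is then known from two numbers, its position (the
  value at the coordinate function) and its value at \<open>U\<close>. Moving \<open>U\<close> past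
  the coordinate function gives an equation between these numbers: \<open>U\<close> vanishes or the
  position is fixed by \<eta>. Since a product of analytic functions vanishes only if a factor does,
  one of the alternatives holds along an entire disc of characters. The discs through fixed points
  are used only in their open form, where the power series converge, and the open mapping theorem
  keeps injective images of discs off the unit circle. A single splitting off of \<open>U\<close>
  takes the place of Fourier expansions: as \<open>U\<close> is an isometry, it can be cancelled on
  the left and remainders of convergent sequences converge.\<close>

lemma coord_minus: "coord (x - y) i = coord x i - coord y i"
  by (simp add: minus_hilbert_sum.rep_eq)

lemma sum_norm_coord_le:
  assumes "finite F"
  shows "(\<Sum>i\<in>F. (norm (coord \<xi> i))\<^sup>2) \<le> (norm \<xi>)\<^sup>2"
  unfolding norm_hilbert_sum_square
  by (rule finite_sum_le_infsum) (auto simp: coord_summable assms)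

lemma norm_coord_le: "norm (coord \<xi> i) \<le> norm \<xi>"
  using sum_norm_coord_le[of "{i}" \<xi>] by (auto intro: power2_le_imp_le)

text \<open>Completeness passes on to the bounded operators, where it supports the fixed point
  argument for characters and the limit case of \<open>semicrossed_decomposition\<close>.\<close>

instance hilbert_sum :: (type, "{real_inner, banach}") banach
proof
  fix X :: "nat \<Rightarrow> ('a, 'b) hilbert_sum"
  assume X: "Cauchy X"
  have "Cauchy (\<lambda>n. coord (X n) i)" for i
  proof (rule CauchyI)
    fix e :: real
    assume "0 < e"
    then obtain N where N: "\<And>m n. m \<ge> N \<Longrightarrow> n \<ge> N \<Longrightarrow> norm (X m - X n) < e"
      using CauchyD[OF X, of e] by blast
    have "norm (coord (X m) i - coord (X n) i) < e" if "m \<ge> N" "n \<ge> N" for m n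
      using norm_coord_le[of "X m - X n" i] N[OF that] by (simp add: coord_minus)
    then show "\<exists>N. \<forall>m\<ge>N. \<forall>n\<ge>N. norm (coord (X m) i - coord (X n) i) < e"
      by blast
  qed
  then have "\<exists>l. (\<lambda>n. coord (X n) i) \<longlonglongrightarrow> l" for i
    using Cauchy_convergent convergent_def by blast
  then obtain l where l: "\<And>i. (\<lambda>n. coord (X n) i) \<longlonglongrightarrow> l i"
    by metis
  \<comment> \<open>Coordinatewise limits commute with finite sums only. The bound is therefore
    uniform over finite \<open>F\<close>, and the infinite sum is reached afterwards as a
    supremum.\<close>
  have tail: "(\<Sum>i\<in>F. (norm (coord (X n) i - l i))\<^sup>2) \<le> e\<^sup>2"
    if "finite F" "\<And>m. m \<ge> N \<Longrightarrow> norm (X n - X m) < e" for F n N and e :: real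
  proof (rule tendsto_upperbound)
    show "(\<lambda>m. \<Sum>i\<in>F. (norm (coord (X n) i - coord (X m) i))\<^sup>2) \<longlonglongrightarrow>
        (\<Sum>i\<in>F. (norm (coord (X n) i - l i))\<^sup>2)"
      by (intro tendsto_intros l)
    show "\<forall>\<^sub>F m in sequentially. (\<Sum>i\<in>F. (norm (coord (X n) i - coord (X m) i))\<^sup>2) \<le> e\<^sup>2"
    proof (rule eventually_sequentiallyI)
      fix m assume m: "N \<le> m"
      have "(\<Sum>i\<in>F. (norm (coord (X n) i - coord (X m) i))\<^sup>2) \<le> (norm (X n - X m))\<^sup>2"
        using sum_norm_coord_le[OF that(1), of "X n - X m"] by (simp add: coord_minus)
      also have "\<dots> \<le> e\<^sup>2"
        using that(2)[OF m] by (intro power_mono) auto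
      finally show "(\<Sum>i\<in>F. (norm (coord (X n) i - coord (X m) i))\<^sup>2) \<le> e\<^sup>2" .
    qed
  qed simp
  have diff: "(\<lambda>i. (norm (coord (X n) i - l i))\<^sup>2) summable_on UNIV"
    if "\<And>m. m \<ge> N \<Longrightarrow> norm (X n - X m) < e" for n N and e :: real
  proof (rule nonneg_bdd_above_summable_on)
    show "bdd_above (sum (\<lambda>i. (norm (coord (X n) i - l i))\<^sup>2) ` {F. F \<subseteq> UNIV \<and> finite F})"
      using tail[OF _ that] by (intro bdd_aboveI2[where M = "e\<^sup>2"]) simp
  qed simp
  obtain N1 where "\<And>m n. m \<ge> N1 \<Longrightarrow> n \<ge> N1 \<Longrightarrow> norm (X m - X n) < 1"
    using CauchyD[OF X, of 1] by auto
  then have "(\<lambda>i. (norm (coord (X N1) i - l i))\<^sup>2) summable_on UNIV"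
    using diff by blast
  then have "(\<lambda>i. (norm (- (coord (X N1) i - l i)))\<^sup>2) summable_on UNIV"
    by (simp only: norm_minus_cancel)
  from square_summable_add[OF coord_summable[of "X N1"] this]
  have "(\<lambda>i. (norm (l i))\<^sup>2) summable_on UNIV"
    by simp
  then have cl: "coord (of_coords l) = l"
    by (simp add: of_coords_inverse)
  have "X \<longlonglongrightarrow> of_coords l"
  proof (rule LIMSEQ_I)
    fix r :: real
    assume "0 < r"
    then obtain N where N: "\<And>m n. m \<ge> N \<Longrightarrow> n \<ge> N \<Longrightarrow> norm (X m - X n) < r / 2"
      using CauchyD[OF X, of "r / 2"] by auto
    have "norm (X n - of_coords l) < r" if "n \<ge> N" for n
    proof -
      have "(norm (X n - of_coords l))\<^sup>2 \<le> (r / 2)\<^sup>2"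
        unfolding norm_hilbert_sum_square coord_minus cl
      proof (rule infsum_le_finite_sums)
        show "(\<lambda>i. (norm (coord (X n) i - l i))\<^sup>2) summable_on UNIV"
          by (rule diff) (rule N[OF that])
        show "(\<Sum>i\<in>F. (norm (coord (X n) i - l i))\<^sup>2) \<le> (r / 2)\<^sup>2" if "finite F" for F
          by (rule tail[OF that]) (rule N[OF \<open>n \<ge> N\<close>])
      qed
      then have "norm (X n - of_coords l) \<le> r / 2"
        by (rule power2_le_imp_le) (simp add: \<open>0 < r\<close> less_imp_le)
      then show ?thesis
        using \<open>0 < r\<close> by simp
    qed
    then show "\<exists>no. \<forall>n\<ge>no. norm (X n - of_coords l) < r"
      by blast
  qed
  then show "convergent X"
    unfolding convergent_def by blast
qed

lemma norm_oplus_le: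
  assumes "\<And>i. norm (T i) \<le> K"
  shows "norm (oplus T) \<le> K"
proof (rule norm_blinfun_bound)
  show K: "0 \<le> K"
    using assms order_trans norm_ge_zero by blast
  fix \<xi>
  have bd: "norm (T i v) \<le> K * norm v" for i v
    by (meson assms mult_right_mono norm_blinfun norm_ge_zero order_trans)
  have sq: "(norm (coord (oplus T \<xi>) i))\<^sup>2 \<le> K\<^sup>2 * (norm (coord \<xi> i))\<^sup>2" for i
    using power_mono[OF bd norm_ge_zero, where n = 2]
    by (simp add: coord_oplus[of T K, OF assms] power_mult_distrib)
  have "(norm (oplus T \<xi>))\<^sup>2 \<le> (\<Sum>\<^sub>\<infinity>i. K\<^sup>2 * (norm (coord \<xi> i))\<^sup>2)"
    unfolding norm_hilbert_sum_square
    by (intro infsum_mono coord_summable summable_on_cmult_right sq)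
  also have "\<dots> = (K * norm \<xi>)\<^sup>2"
    by (simp add: infsum_cmult_right' norm_hilbert_sum_square power_mult_distrib)
  finally show "norm (oplus T \<xi>) \<le> K * norm \<xi>"
    by (rule power2_le_imp_le) (simp add: K)
qed

section \<open>The disc algebra\<close>

lemma disc_algebra_const: "(\<lambda>_. c) \<in> disc_algebra"
  and disc_algebra_id: "(\<lambda>z. z) \<in> disc_algebra"
  by (auto simp: disc_algebra_def)

lemma disc_algebra_add: "f \<in> disc_algebra \<Longrightarrow> g \<in> disc_algebra \<Longrightarrow> (\<lambda>z. f z + g z) \<in> disc_algebra"
  and disc_algebra_diff: "f \<in> disc_algebra \<Longrightarrow> g \<in> disc_algebra \<Longrightarrow> (\<lambda>z. f z - g z) \<in> disc_algebra"
  and disc_algebra_mult: "f \<in> disc_algebra \<Longrightarrow> g \<in> disc_algebra \<Longrightarrow> (\<lambda>z. f z * g z) \<in> disc_algebra"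
  by (simp_all add: disc_algebra_def continuous_intros holomorphic_intros)

lemma disc_algebra_cong:
  assumes "f \<in> disc_algebra" "\<And>z. z \<in> cball 0 1 \<Longrightarrow> g z = f z"
  shows "g \<in> disc_algebra"
proof -
  have "continuous_on (cball 0 1) g = continuous_on (cball 0 1) f"
    "g holomorphic_on ball 0 1 \<longleftrightarrow> f holomorphic_on ball 0 1"
    using assms(2) by (auto intro!: continuous_on_cong holomorphic_cong)
  then show ?thesis
    using assms(1) by (simp add: disc_algebra_def)
qed

lemma disc_algebra_uniform_limit:
  assumes "\<And>n. F n \<in> disc_algebra" "uniform_limit (cball 0 1) F f sequentially"
  shows "f \<in> disc_algebra"
  using holomorphic_uniform_limit[of 0 1 F sequentially f] assms by (auto simp: disc_algebra_def)

text \<open>By the open mapping theorem the image is open, and an open subset of the closed disc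
  lies in its interior.\<close>

lemma holomorphic_bounded_not_constant:
  assumes p: "p holomorphic_on ball 0 1" "\<And>w. w \<in> ball 0 1 \<Longrightarrow> cmod (p w) \<le> 1"
    and nc: "\<not> p constant_on ball 0 1"
  shows "open (p ` ball 0 1)" "p ` ball 0 1 \<subseteq> ball 0 1"
proof -
  show op: "open (p ` ball 0 1)"
    using open_mapping_thm[OF p(1) open_ball connected_ball open_ball _ nc] by auto
  have "p ` ball 0 1 \<subseteq> cball 0 1"
    using p(2) by auto
  then have "p ` ball 0 1 \<subseteq> interior (cball 0 1)"
    by (rule interior_maximal[OF _ op])
  then show "p ` ball 0 1 \<subseteq> ball 0 1"
    by simp
qed

lemma holomorphic_zero_on_open:
  assumes "f holomorphic_on ball 0 1" "open V" "V \<noteq> {}" "V \<subseteq> ball 0 1"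
    and "\<And>z. z \<in> V \<Longrightarrow> f z = 0" and "w \<in> ball 0 1"
  shows "f w = 0"
proof -
  obtain v where "v \<in> V"
    using assms(3) by blast
  then have "v islimpt V"
    using assms(2) by (simp add: interior_limit_point interior_open)
  then show ?thesis
    using analytic_continuation[OF assms(1) open_ball connected_ball assms(4)] assms \<open>v \<in> V\<close> by blast
qed

text \<open>If \<open>g\<close> is nonzero somewhere, it is so on an open set; there
  \<open>f\<close> vanishes, and the identity theorem extends this to the disc.\<close>

lemma holomorphic_mult_eq_zero:
  assumes f: "f holomorphic_on ball 0 1" and g: "g holomorphic_on ball 0 1"
    and fg: "\<And>z. z \<in> ball 0 1 \<Longrightarrow> f z * g z = 0"
  shows "(\<forall>z\<in>ball 0 1. f z = 0) \<or> (\<forall>z\<in>ball 0 1. g z = 0)"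
proof (rule disjCI)
  assume "\<not> (\<forall>z\<in>ball 0 1. g z = 0)"
  then obtain z0 where z0: "z0 \<in> ball 0 1" "g z0 \<noteq> 0"
    by blast
  let ?V = "ball 0 1 \<inter> g -` (- {0})"
  have "open ?V"
    using holomorphic_on_imp_continuous_on[OF g] by (intro continuous_open_preimage) auto
  then have "f z = 0" if "z \<in> ball 0 1" for z
    by (rule holomorphic_zero_on_open[OF f _ _ _ _ that]) (use z0 fg in auto)
  then show "\<forall>z\<in>ball 0 1. f z = 0"
    by blast
qed

lemma continuous_zero_cball:
  fixes f :: "complex \<Rightarrow> complex"
  assumes "continuous_on (cball 0 1) f" "\<And>z. z \<in> ball 0 1 \<Longrightarrow> f z = c" "z \<in> cball 0 1"
  shows "f z = c"
  using continuous_constant_on_closure[of "ball 0 1" f c z] assms by simp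

lemma disc_algebra_mult_eq_zero:
  assumes "f \<in> disc_algebra" "g \<in> disc_algebra" "\<And>z. z \<in> cball 0 1 \<Longrightarrow> f z * g z = 0"
  shows "(\<forall>z\<in>cball 0 1. f z = 0) \<or> (\<forall>z\<in>cball 0 1. g z = 0)"
proof -
  have "(\<forall>z\<in>ball 0 1. f z = 0) \<or> (\<forall>z\<in>ball 0 1. g z = 0)"
    by (rule holomorphic_mult_eq_zero) (use assms in \<open>simp_all add: disc_algebra_def\<close>)
  then show ?thesis
  proof
    assume "\<forall>z\<in>ball 0 1. f z = 0"
    then show ?thesis
      using continuous_zero_cball[of f 0] assms(1) by (auto simp: disc_algebra_def)
  next
    assume "\<forall>z\<in>ball 0 1. g z = 0"
    then show ?thesis
      using continuous_zero_cball[of g 0] assms(2) by (auto simp: disc_algebra_def)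
  qed
qed

lemma disc_map_bound: "disc_map \<eta> \<Longrightarrow> z \<in> cball 0 1 \<Longrightarrow> \<eta> z \<in> cball 0 1"
  unfolding disc_map_def by blast

lemma disc_map_in_algebra: "disc_map \<eta> \<Longrightarrow> \<eta> \<in> disc_algebra"
  by (simp add: disc_map_def)

text \<open>A nonconstant holomorphic family of fixed points would sweep out an open set.\<close>

lemma holomorphic_fixed_points_constant:
  assumes \<eta>: "disc_map \<eta>" "\<not> (\<forall>z\<in>cball 0 1. \<eta> z = z)"
    and p: "p holomorphic_on ball 0 1" "\<And>w. w \<in> ball 0 1 \<Longrightarrow> cmod (p w) \<le> 1"
    and fixed: "\<And>w. w \<in> ball 0 1 \<Longrightarrow> \<eta> (p w) = p w"
  shows "p constant_on ball 0 1"
proof (rule ccontr)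
  assume "\<not> p constant_on ball 0 1"
  note img = holomorphic_bounded_not_constant[OF p this]
  have "(\<lambda>z. \<eta> z - z) \<in> disc_algebra"
    using \<eta>(1) by (auto intro: disc_algebra_diff disc_algebra_id disc_map_in_algebra)
  then have *: "continuous_on (cball 0 1) (\<lambda>z. \<eta> z - z)" "(\<lambda>z. \<eta> z - z) holomorphic_on ball 0 1"
    by (auto simp: disc_algebra_def)
  have "\<eta> z - z = 0" if "z \<in> ball 0 1" for z
    by (rule holomorphic_zero_on_open[OF *(2) img(1) _ img(2)]) (use fixed that in auto)
  then have "\<eta> z - z = 0" if "z \<in> cball 0 1" for z
    using continuous_zero_cball[OF *(1)] that by blast
  then show False
    using \<eta>(2) by auto
qed

text \<open>As \<open>f\<close> is analytic only in the open disc, interior points must not be sent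
  to the circle. A nonconstant \<eta> cannot do so; a constant one makes the composition
  constant.\<close>

lemma disc_algebra_compose:
  assumes f: "f \<in> disc_algebra" and \<eta>: "disc_map \<eta>"
  shows "(\<lambda>z. f (\<eta> z)) \<in> disc_algebra"
proof -
  have c: "continuous_on (cball 0 1) (\<lambda>z. f (\<eta> z))"
    by (rule continuous_on_compose2[of "cball 0 1" f "cball 0 1" \<eta>])
      (use f \<eta> in \<open>simp_all add: disc_algebra_def disc_map_def\<close>)
  have "(\<lambda>z. f (\<eta> z)) holomorphic_on ball 0 1"
  proof (cases "\<eta> constant_on ball 0 1")
    case True
    then obtain c where "\<And>z. z \<in> ball 0 1 \<Longrightarrow> \<eta> z = c"
      by (auto simp: constant_on_def)
    then have "(\<lambda>z. f (\<eta> z)) holomorphic_on ball 0 1 \<longleftrightarrow> (\<lambda>z. f c) holomorphic_on ball 0 1"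
      by (intro holomorphic_cong) auto
    then show ?thesis
      by simp
  next
    case False
    then have "\<eta> ` ball 0 1 \<subseteq> ball 0 1"
      using disc_map_bound[OF \<eta>] disc_map_in_algebra[OF \<eta>]
      by (intro holomorphic_bounded_not_constant) (simp_all add: disc_algebra_def)
    then show ?thesis
      using f disc_map_in_algebra[OF \<eta>] holomorphic_on_compose_gen[of \<eta> "ball 0 1" f "ball 0 1"]
      by (simp add: disc_algebra_def o_def)
  qed
  with c show ?thesis
    by (simp add: disc_algebra_def)
qed

section \<open>Norm closed algebras and their characters\<close>

lemma cscale_op_apply: "cscale_op c T \<xi> = c *\<^sub>C T \<xi>"
  by (simp add: cscale_op.rep_eq)

lemma norm_cscale_op_le: "norm (cscale_op c T) \<le> cmod c * norm T"
proof (rule norm_blinfun_bound)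
  show "norm (cscale_op c T \<xi>) \<le> cmod c * norm T * norm \<xi>" for \<xi>
    by (simp add: cscale_op_apply norm_cscale mult.assoc mult_left_mono norm_blinfun)
qed simp

lemma cscale_op_comp: "cscale_op c S o\<^sub>L T = cscale_op c (S o\<^sub>L T)"
  by (rule blinfun_eqI) (simp add: cscale_op_apply)

lemma blinfun_compose_assoc: "(R o\<^sub>L S) o\<^sub>L T = R o\<^sub>L (S o\<^sub>L T)"
  by (rule blinfun_eqI) simp

lemma norm_closed_algebraD:
  assumes "norm_closed_algebra A"
  shows "0 \<in> A" "S \<in> A \<Longrightarrow> T \<in> A \<Longrightarrow> S + T \<in> A" "S \<in> A \<Longrightarrow> T \<in> A \<Longrightarrow> S o\<^sub>L T \<in> A"
    "T \<in> A \<Longrightarrow> cscale_op c T \<in> A" "closed A"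
  using assms by (auto simp: norm_closed_algebra_def operator_algebra_def)

lemma norm_closed_algebra_diff:
  assumes "norm_closed_algebra A" "S \<in> A" "T \<in> A"
  shows "S - T \<in> A"
proof -
  have "cscale_op (-1) T = - T"
    using cscale_of_real[of "-1"] by (intro blinfun_eqI) (simp add: cscale_op_apply blinfun.minus_left)
  then show ?thesis
    using norm_closed_algebraD[OF assms(1)] assms by (metis uminus_add_conv_diff add.commute)
qed

text \<open>Continuity is left out so that composition with an algebraic isomorphism gives a
  character again.\<close>

definition character :: "('a::complex_scalars \<Rightarrow>\<^sub>L 'a) set \<Rightarrow> (('a \<Rightarrow>\<^sub>L 'a) \<Rightarrow> complex) \<Rightarrow> bool"
  where "character A \<rho> \<longleftrightarrow> (\<exists>T\<in>A. \<rho> T \<noteq> 0) \<and>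
    (\<forall>S\<in>A. \<forall>T\<in>A. \<rho> (S + T) = \<rho> S + \<rho> T \<and> \<rho> (S o\<^sub>L T) = \<rho> S * \<rho> T) \<and>
    (\<forall>c. \<forall>T\<in>A. \<rho> (cscale_op c T) = c * \<rho> T)"

lemma characterD:
  assumes "character A \<rho>"
  shows "S \<in> A \<Longrightarrow> T \<in> A \<Longrightarrow> \<rho> (S + T) = \<rho> S + \<rho> T"
    "S \<in> A \<Longrightarrow> T \<in> A \<Longrightarrow> \<rho> (S o\<^sub>L T) = \<rho> S * \<rho> T"
    "T \<in> A \<Longrightarrow> \<rho> (cscale_op c T) = c * \<rho> T"
  using assms by (auto simp: character_def)

lemma character_id:
  assumes "character A \<rho>" "id_blinfun \<in> A"
  shows "\<rho> id_blinfun = 1"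
proof -
  obtain T where "T \<in> A" "\<rho> T \<noteq> 0"
    using assms(1) by (auto simp: character_def)
  moreover have "id_blinfun o\<^sub>L T = T"
    by (rule blinfun_eqI) simp
  ultimately show ?thesis
    using characterD(2)[OF assms, of T] by simp
qed

text \<open>
  Automatic continuity: if \<open>\<rho> a = 1\<close> and \<open>\<parallel>a\<parallel> < 1\<close>, the contraction \<open>S \<mapsto> 1 + a S\<close> has a fixed
  point, at which \<open>\<rho>\<close> cannot be defined.
\<close>

lemma character_norm_le:
  fixes A :: "('a::{complex_scalars, banach} \<Rightarrow>\<^sub>L 'a) set"
  assumes A: "norm_closed_algebra A" "id_blinfun \<in> A" and \<rho>: "character A \<rho>" and T: "T \<in> A"
  shows "cmod (\<rho> T) \<le> norm T"
proof (rule ccontr)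
  assume lt: "\<not> cmod (\<rho> T) \<le> norm T"
  then have nz: "\<rho> T \<noteq> 0"
    by auto
  note alg = norm_closed_algebraD[OF A(1)]
  define a where "a = cscale_op (inverse (\<rho> T)) T"
  have a: "a \<in> A" "\<rho> a = 1"
    using T nz characterD(3)[OF \<rho> T] by (simp_all add: a_def alg)
  have "norm a \<le> norm T / cmod (\<rho> T)"
    using norm_cscale_op_le[of "inverse (\<rho> T)" T] by (simp add: a_def norm_inverse divide_inverse mult.commute)
  also have "\<dots> < 1"
    using lt nz by simp
  finally have small: "norm a < 1" .
  have "\<exists>!S\<in>A. id_blinfun + (a o\<^sub>L S) = S"
  proof (rule Banach_fix)
    show "complete A" "A \<noteq> {}"
      using alg A(2) by (auto simp: complete_eq_closed)
    show "0 \<le> norm a" "norm a < 1"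
      by (simp_all add: small)
    show "(\<lambda>S. id_blinfun + (a o\<^sub>L S)) ` A \<subseteq> A"
      using alg A(2) a by auto
    show "dist (id_blinfun + (a o\<^sub>L R)) (id_blinfun + (a o\<^sub>L S)) \<le> norm a * dist R S" for R S
      using norm_blinfun_compose[of a "R - S"]
      by (simp add: dist_norm bounded_bilinear.diff_right[OF bounded_bilinear_blinfun_compose])
  qed
  then obtain S where S: "S \<in> A" "S = id_blinfun + (a o\<^sub>L S)"
    by metis
  then have "\<rho> S = \<rho> id_blinfun + \<rho> a * \<rho> S"
    using characterD[OF \<rho>] alg A(2) a(1) by metis
  then show False
    using character_id[OF \<rho> A(2)] a(2) by simp
qed

section \<open>Structure of the semicrossed product\<close>

type_synonym orbit_space = "(disc, l2) hilbert_sum"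

definition mult_op :: "(complex \<Rightarrow> complex) \<Rightarrow> (complex \<Rightarrow> complex) \<Rightarrow> orbit_space \<Rightarrow>\<^sub>L orbit_space"
  where "mult_op \<eta> f = oplus (\<lambda>x. orbit_rep \<eta> x f)"

definition shift_op :: "orbit_space \<Rightarrow>\<^sub>L orbit_space"
  where "shift_op = oplus (\<lambda>_. shift)"

lemma coord_mult_op:
  assumes "disc_map \<eta>" "f \<in> disc_algebra"
  shows "coord (coord (mult_op \<eta> f \<xi>) x) n = f ((\<eta> ^^ n) (of_disc x)) * coord (coord \<xi> x) n"
  using coord_semicrossed_generators(1)[OF assms] by (simp add: mult_op_def)

lemma norm_shift: "norm shift \<le> 1"
  by (rule norm_blinfun_bound) (simp_all add: shift_isometry)

lemma norm_shift_op: "norm shift_op \<le> 1"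
  unfolding shift_op_def by (rule norm_oplus_le) (rule norm_shift)

lemma coord_shift_op: "coord (shift_op \<xi>) x = shift (coord \<xi> x)"
  unfolding shift_op_def by (rule coord_oplus) (rule norm_shift)

lemma coord_coord_shift_op:
  "coord (coord (shift_op \<xi>) x) n = (case n of 0 \<Rightarrow> 0 | Suc m \<Rightarrow> coord (coord \<xi> x) m)"
  by (simp add: coord_shift_op shift_isometry)

lemma norm_shift_op_apply: "norm (shift_op \<xi>) = norm \<xi>"
proof -
  have "(norm (shift_op \<xi>))\<^sup>2 = (norm \<xi>)\<^sup>2"
    by (simp add: norm_hilbert_sum_square coord_shift_op shift_isometry)
  then show ?thesis
    by simp
qed

text \<open>The shift is an isometry. Left cancellation plays the part of comparing Fourier
  coefficients.\<close>

lemma shift_op_cancel: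
  assumes "shift_op o\<^sub>L S = shift_op o\<^sub>L T"
  shows "S = T"
proof (rule blinfun_eqI)
  fix \<xi>
  have "shift_op (S \<xi>) = shift_op (T \<xi>)"
    using assms by (metis blinfun_apply_blinfun_compose)
  then have "shift_op (S \<xi> - T \<xi>) = 0"
    by (simp add: blinfun.diff_right)
  then have "norm (S \<xi> - T \<xi>) = 0"
    by (metis norm_shift_op_apply norm_zero)
  then show "S \<xi> = T \<xi>"
    by simp
qed

lemma norm_shift_op_comp: "norm T \<le> norm (shift_op o\<^sub>L T)"
  by (rule norm_blinfun_bound)
    (use norm_blinfun[of "shift_op o\<^sub>L T"] in \<open>simp_all add: norm_shift_op_apply\<close>)

lemma orbit_space_eqI:
  fixes \<xi> \<zeta> :: orbit_space
  assumes "\<And>x n. coord (coord \<xi> x) n = coord (coord \<zeta> x) n"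
  shows "\<xi> = \<zeta>"
  by (metis assms coord_inject ext)

lemma orbit_op_eqI:
  fixes S T :: "'a::real_normed_vector \<Rightarrow>\<^sub>L orbit_space"
  assumes "\<And>\<xi> x n. coord (coord (S \<xi>) x) n = coord (coord (T \<xi>) x) n"
  shows "S = T"
  by (intro blinfun_eqI orbit_space_eqI assms)

lemma coord_cscale: "coord (coord (c *\<^sub>C (\<xi>::orbit_space)) x) n = c * coord (coord \<xi> x) n"
  and coord_add: "coord (coord (\<xi> + \<zeta> :: orbit_space) x) n = coord (coord \<xi> x) n + coord (coord \<zeta> x) n"
  by (simp_all add: cscale_hilbert_sum.rep_eq plus_hilbert_sum.rep_eq cscale_complex_def)

lemma coord_zero: "coord (coord (0::orbit_space) x) n = 0"
  by (simp add: zero_hilbert_sum.rep_eq)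

context
  fixes \<eta>
  assumes \<eta>: "disc_map \<eta>"
begin

lemma norm_mult_op:
  assumes "0 \<le> K" "\<And>z. z \<in> cball 0 1 \<Longrightarrow> cmod (f z) \<le> K"
  shows "norm (mult_op \<eta> f) \<le> K"
  unfolding mult_op_def by (intro norm_oplus_le orbit_rep_bounded(2) \<eta> assms)

lemma mult_op_add:
  assumes "f \<in> disc_algebra" "g \<in> disc_algebra"
  shows "mult_op \<eta> (\<lambda>z. f z + g z) = mult_op \<eta> f + mult_op \<eta> g"
  using assms by (intro orbit_op_eqI)
    (simp add: coord_mult_op \<eta> disc_algebra_add blinfun.add_left coord_add algebra_simps)

lemma mult_op_mult:
  assumes "f \<in> disc_algebra" "g \<in> disc_algebra"
  shows "mult_op \<eta> (\<lambda>z. f z * g z) = mult_op \<eta> f o\<^sub>L mult_op \<eta> g"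
  using assms by (intro orbit_op_eqI) (simp add: coord_mult_op \<eta> disc_algebra_mult)

lemma mult_op_const: "mult_op \<eta> (\<lambda>_. c) = cscale_op c id_blinfun"
  by (intro orbit_op_eqI) (simp add: coord_mult_op \<eta> disc_algebra_const cscale_op_apply coord_cscale)

lemma mult_op_one: "mult_op \<eta> (\<lambda>_. 1) = id_blinfun"
  by (intro orbit_op_eqI) (simp add: coord_mult_op \<eta> disc_algebra_const)

lemma mult_op_zero: "mult_op \<eta> (\<lambda>_. 0) = 0"
  by (intro orbit_op_eqI) (simp add: coord_mult_op \<eta> disc_algebra_const coord_zero)

lemma mult_op_scale:
  assumes "f \<in> disc_algebra"
  shows "mult_op \<eta> (\<lambda>z. c * f z) = cscale_op c (mult_op \<eta> f)"
  using assms disc_algebra_mult[OF disc_algebra_const[of c] assms]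
  by (intro orbit_op_eqI) (simp add: coord_mult_op \<eta> cscale_op_apply coord_cscale)

lemma mult_op_diff:
  assumes "f \<in> disc_algebra" "g \<in> disc_algebra"
  shows "mult_op \<eta> (\<lambda>z. f z - g z) = mult_op \<eta> f - mult_op \<eta> g"
  using mult_op_add[OF disc_algebra_diff[OF assms] assms(2)] by (simp add: eq_diff_eq)

lemma mult_op_cong:
  assumes "\<And>z. z \<in> cball 0 1 \<Longrightarrow> f z = g z" "f \<in> disc_algebra"
  shows "mult_op \<eta> f = mult_op \<eta> g"
  using assms disc_algebra_cong[of f g] funpow_disc_map[OF \<eta>]
  by (intro orbit_op_eqI) (simp add: coord_mult_op \<eta>)

text \<open>Place \<open>Suc m\<close> of an orbit of \<open>x\<close> carries the value of
  \<open>f\<close> at \<eta> applied to place \<open>m\<close>; place 0 is emptied by the shift on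
  both sides.\<close>

lemma mult_op_shift:
  assumes "f \<in> disc_algebra"
  shows "mult_op \<eta> f o\<^sub>L shift_op = shift_op o\<^sub>L mult_op \<eta> (\<lambda>z. f (\<eta> z))"
  using assms
  by (intro orbit_op_eqI)
    (simp add: coord_mult_op \<eta> coord_coord_shift_op disc_algebra_compose split: nat.split)

section \<open>Generation by multiplication operators and the shift\<close>

lemma semicrossed_generators:
  "semicrossed_product \<eta> = norm_closed_algebra hull
    ({mult_op \<eta> f | f. f \<in> disc_algebra} \<union> {shift_op o\<^sub>L mult_op \<eta> f | f. f \<in> disc_algebra})"
proof -
  have "oplus (\<lambda>x. shift o\<^sub>L orbit_rep \<eta> x f) = shift_op o\<^sub>L mult_op \<eta> f" if "f \<in> disc_algebra" for f
    by (intro orbit_op_eqI)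
      (simp add: coord_semicrossed_generators(2) coord_mult_op \<eta> coord_coord_shift_op that
        split: nat.split)
  then have *: "{oplus (\<lambda>x. shift o\<^sub>L orbit_rep \<eta> x f) | f. f \<in> disc_algebra} =
      {shift_op o\<^sub>L mult_op \<eta> f | f. f \<in> disc_algebra}"
    by (metis (no_types, lifting))
  show ?thesis
    unfolding semicrossed_product_def * mult_op_def[symmetric] ..
qed

lemma semicrossed_algebra: "norm_closed_algebra (semicrossed_product \<eta>)"
  unfolding semicrossed_product_def by (rule norm_closed_algebra_hull)

lemmas semicrossed_closure = norm_closed_algebraD[OF semicrossed_algebra]
  norm_closed_algebra_diff[OF semicrossed_algebra]

lemma mult_op_in: "f \<in> disc_algebra \<Longrightarrow> mult_op \<eta> f \<in> semicrossed_product \<eta>"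
  unfolding semicrossed_generators by (intro hull_inc) blast

lemma id_in: "id_blinfun \<in> semicrossed_product \<eta>"
  using mult_op_in[OF disc_algebra_const[of 1]] by (simp add: mult_op_one)

lemma shift_op_in: "shift_op \<in> semicrossed_product \<eta>"
proof -
  have "shift_op o\<^sub>L mult_op \<eta> (\<lambda>_. 1) \<in> semicrossed_product \<eta>"
    unfolding semicrossed_generators using disc_algebra_const by (intro hull_inc) blast
  moreover have "shift_op o\<^sub>L id_blinfun = shift_op"
    by (rule blinfun_eqI) simp
  ultimately show ?thesis
    by (simp add: mult_op_one)
qed

lemma semicrossed_subset:
  assumes "norm_closed_algebra B" "\<And>f. f \<in> disc_algebra \<Longrightarrow> mult_op \<eta> f \<in> B" "shift_op \<in> B"
  shows "semicrossed_product \<eta> \<subseteq> B"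
  unfolding semicrossed_generators
  by (rule hull_minimal) (use assms norm_closed_algebraD(3)[OF assms(1)] in auto)

end

text \<open>The elements of the algebra with property \<open>P\<close> form a norm closed algebra
  containing the generators. Membership is handed to each case, since most properties make sense
  only inside the algebra.\<close>

lemma semicrossed_induct [consumes 2, case_names mult shift add comp scale limit]:
  assumes \<eta>: "disc_map \<eta>" and T: "T \<in> semicrossed_product \<eta>"
    and mult: "\<And>f. f \<in> disc_algebra \<Longrightarrow> P (mult_op \<eta> f)"
    and shift: "P shift_op"
    and add: "\<And>S T. S \<in> semicrossed_product \<eta> \<Longrightarrow> T \<in> semicrossed_product \<eta> \<Longrightarrow> P S \<Longrightarrow> P T \<Longrightarrow> P (S + T)"
    and comp: "\<And>S T. S \<in> semicrossed_product \<eta> \<Longrightarrow> T \<in> semicrossed_product \<eta> \<Longrightarrow> P S \<Longrightarrow> P T \<Longrightarrow> P (S o\<^sub>L T)"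
    and scale: "\<And>c T. T \<in> semicrossed_product \<eta> \<Longrightarrow> P T \<Longrightarrow> P (cscale_op c T)"
    and limit: "\<And>X T. (\<And>n::nat. X n \<in> semicrossed_product \<eta>) \<Longrightarrow> (\<And>n. P (X n)) \<Longrightarrow>
      X \<longlonglongrightarrow> T \<Longrightarrow> T \<in> semicrossed_product \<eta> \<Longrightarrow> P T"
  shows "P T"
proof -
  let ?B = "{T \<in> semicrossed_product \<eta>. P T}"
  have "P 0"
    using mult[OF disc_algebra_const[of 0]] by (simp add: mult_op_zero \<eta>)
  moreover have "closed ?B"
    unfolding closed_sequential_limits
    using limit semicrossed_closure(5)[OF \<eta>] closed_sequentially by blast
  ultimately have "norm_closed_algebra ?B"
    unfolding norm_closed_algebra_def operator_algebra_def
    by (simp add: semicrossed_closure \<eta> add comp scale)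
  then have "semicrossed_product \<eta> \<subseteq> ?B"
    by (rule semicrossed_subset[OF \<eta>]) (auto simp: mult shift mult_op_in shift_op_in \<eta>)
  then show ?thesis
    using T by blast
qed

context
  fixes \<eta>
  assumes \<eta>: "disc_map \<eta>"
begin

text \<open>The operator type guarantees real linearity only; complex linearity holds for the
  generators and survives the algebra operations and limits.\<close>

lemma semicrossed_complex_linear:
  assumes "T \<in> semicrossed_product \<eta>"
  shows "T (c *\<^sub>C \<xi>) = c *\<^sub>C T \<xi>"
  using \<eta> assms
proof (induction arbitrary: \<xi> rule: semicrossed_induct)
  case (mult f)
  then show ?case
    by (intro orbit_space_eqI) (simp add: coord_mult_op \<eta> coord_cscale)
next
  case shift
  show ?case
    by (intro orbit_space_eqI) (simp add: coord_coord_shift_op coord_cscale split: nat.split)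
next
  case (scale d T)
  then show ?case
    by (simp add: cscale_op_apply cscale_cscale mult.commute)
next
  case (limit X T)
  have "(\<lambda>n. X n (c *\<^sub>C \<xi>)) \<longlonglongrightarrow> T (c *\<^sub>C \<xi>)"
    by (intro tendsto_intros limit)
  moreover have "(\<lambda>n. c *\<^sub>C X n \<xi>) \<longlonglongrightarrow> c *\<^sub>C T \<xi>"
    by (intro bounded_linear.tendsto[OF bounded_linear_cscale] tendsto_intros limit)
  ultimately show ?case
    unfolding limit.IH by (rule LIMSEQ_unique)
qed (simp_all add: blinfun.add_left cscale_add_right)

lemma semicrossed_comp_scale:
  "S \<in> semicrossed_product \<eta> \<Longrightarrow> S o\<^sub>L cscale_op c T = cscale_op c (S o\<^sub>L T)"
  by (rule blinfun_eqI) (simp add: cscale_op_apply semicrossed_complex_linear)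

end

section \<open>Point characters\<close>

definition single :: "'i \<Rightarrow> 'a::real_inner \<Rightarrow> ('i, 'a) hilbert_sum"
  where "single i v = of_coords (\<lambda>j. if j = i then v else 0)"

lemma coord_single: "coord (single i v) j = (if j = i then v else 0)"
proof -
  have "(\<lambda>j. (norm (if j = i then v else 0))\<^sup>2) summable_on {i}"
    by simp
  then have "(\<lambda>j. (norm (if j = i then v else 0))\<^sup>2) summable_on UNIV"
    by (rule summable_on_cong_neutral[THEN iffD1, rotated -1]) auto
  then show ?thesis
    by (simp add: single_def of_coords_inverse)
qed

lemma norm_single: "norm (single i v) = norm v"
proof -
  have "(norm (single i v))\<^sup>2 = (\<Sum>\<^sub>\<infinity>j. (norm (if j = i then v else 0))\<^sup>2)"
    by (simp add: norm_hilbert_sum_square coord_single)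
  also have "\<dots> = (\<Sum>\<^sub>\<infinity>j\<in>{i}. (norm (if j = i then v else 0))\<^sup>2)"
    by (rule infsum_cong_neutral) auto
  finally show ?thesis
    by simp
qed

text \<open>
  For \<open>w = 0\<close> or a fixed point \<open>z\<close>, this functional is an eigenvector of the adjoints of all
  operators in the semicrossed product; the eigenvalue at \<open>\<Sum>n. U\<^sup>n f\<^sub>n\<close> is \<open>\<Sum>n. f\<^sub>n(z) w\<^sup>n\<close>.
\<close>

definition point_sum :: "complex \<Rightarrow> complex \<Rightarrow> orbit_space \<Rightarrow> complex"
  where "point_sum z w \<xi> = (\<Sum>n. coord (coord \<xi> (to_disc z)) n * w ^ n)"

lemma norm_coord_coord_le: "norm (coord (coord \<xi> x) n) \<le> norm \<xi>"
  by (rule order_trans[OF norm_coord_le norm_coord_le])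

lemma point_sum_summable:
  assumes "w \<in> ball 0 1"
  shows "summable (\<lambda>n. norm (coord (coord \<xi> x) n * w ^ n))"
    and "summable (\<lambda>n. coord (coord (\<xi>::orbit_space) x) n * w ^ n)"
proof -
  show "summable (\<lambda>n. norm (coord (coord \<xi> x) n * w ^ n))"
  proof (rule summable_comparison_test)
    show "summable (\<lambda>n. norm \<xi> * norm w ^ n)"
      using assms by (intro summable_mult summable_geometric) simp
    show "\<exists>N. \<forall>n\<ge>N. norm (norm (coord (coord \<xi> x) n * w ^ n)) \<le> norm \<xi> * norm w ^ n"
      by (auto simp: norm_mult norm_power intro!: mult_right_mono norm_coord_coord_le)
  qed
  then show "summable (\<lambda>n. coord (coord \<xi> x) n * w ^ n)"
    by (rule summable_norm_cancel)
qed

lemma point_sum_zero: "point_sum z 0 \<xi> = coord (coord \<xi> (to_disc z)) 0"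
  unfolding point_sum_def by (rule powser_zero)

lemma norm_point_sum_le:
  assumes "w \<in> ball 0 1"
  shows "cmod (point_sum z w \<xi>) \<le> norm \<xi> * (1 / (1 - cmod w))"
proof -
  have "cmod (point_sum z w \<xi>) \<le> (\<Sum>n. norm (coord (coord \<xi> (to_disc z)) n * w ^ n))"
    unfolding point_sum_def by (rule summable_norm) (rule point_sum_summable(1)[OF assms])
  also have "\<dots> \<le> (\<Sum>n. norm \<xi> * norm w ^ n)"
    using assms by (intro suminf_le point_sum_summable(1)[OF assms] summable_mult summable_geometric)
      (auto simp: norm_mult norm_power intro!: mult_right_mono norm_coord_coord_le)
  also have "\<dots> = norm \<xi> * (1 / (1 - cmod w))"
    using assms by (simp add: suminf_mult suminf_geometric)
  finally show ?thesis .
qed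

lemma point_sum_add:
  "w \<in> ball 0 1 \<Longrightarrow> point_sum z w (\<xi> + \<zeta>) = point_sum z w \<xi> + point_sum z w \<zeta>"
  unfolding point_sum_def
  by (subst suminf_add) (simp_all add: point_sum_summable coord_add distrib_right)

lemma point_sum_cscale:
  assumes "w \<in> ball 0 1"
  shows "point_sum z w (c *\<^sub>C \<xi>) = c * point_sum z w \<xi>"
  unfolding point_sum_def
  using suminf_mult[OF point_sum_summable(2)[OF assms], where c = c]
  by (simp add: coord_cscale mult.assoc)

lemma bounded_linear_point_sum:
  assumes "w \<in> ball 0 1"
  shows "bounded_linear (point_sum z w)"
proof (rule bounded_linear_intro)
  show "point_sum z w (r *\<^sub>R \<xi>) = r *\<^sub>R point_sum z w \<xi>" for r \<xi>
    using point_sum_cscale[OF assms, of z "of_real r" \<xi>]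
    by (simp add: cscale_of_real scaleR_conv_of_real)
qed (use assms in \<open>auto simp: point_sum_add intro: norm_point_sum_le\<close>)

lemma point_sum_shift:
  assumes "w \<in> ball 0 1"
  shows "point_sum z w (shift_op \<xi>) = w * point_sum z w \<xi>"
proof -
  let ?a = "\<lambda>n. coord (coord (shift_op \<xi>) (to_disc z)) n * w ^ n"
  have "suminf ?a = (\<Sum>n. ?a (Suc n)) + ?a 0"
    using suminf_split_head[OF point_sum_summable(2)[OF assms]] by simp
  also have "\<dots> = (\<Sum>n. w * (coord (coord \<xi> (to_disc z)) n * w ^ n))"
    by (simp add: coord_coord_shift_op algebra_simps)
  also have "\<dots> = w * point_sum z w \<xi>"
    unfolding point_sum_def by (rule suminf_mult[OF point_sum_summable(2)[OF assms]])
  finally show ?thesis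
    by (simp add: point_sum_def)
qed

text \<open>The unit vector at place 0 over \<open>z\<close> has \<open>point_sum\<close> equal to
  1, so this expression reads off the eigenvalue whenever \<open>point_sum z w\<close> is an
  eigenvector.\<close>

definition char_at :: "complex \<Rightarrow> complex \<Rightarrow> (orbit_space \<Rightarrow>\<^sub>L orbit_space) \<Rightarrow> complex"
  where "char_at z w T = point_sum z w (T (single (to_disc z) (single 0 1)))"

lemma point_sum_single: "point_sum z w (single (to_disc z) (single 0 1)) = 1"
proof -
  have "(\<lambda>n. coord (coord (single (to_disc z) (single 0 1)) (to_disc z)) n * w ^ n) =
      (\<lambda>n. if n = 0 then 1 else 0)"
    by (auto simp: coord_single)
  then show ?thesis
    unfolding point_sum_def using sums_unique[OF sums_single[of 0 "\<lambda>_. 1 :: complex"]] by simp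
qed

lemma char_at_shift: "w \<in> ball 0 1 \<Longrightarrow> char_at z w shift_op = w"
  by (simp add: char_at_def point_sum_shift point_sum_single)

text \<open>For fixed \<open>z\<close> and \<open>T\<close> this is a power series in
  \<open>w\<close>, with the coordinates of one fixed vector as coefficients.\<close>

lemma char_at_holomorphic: "(\<lambda>w. char_at z w T) holomorphic_on ball 0 1"
proof (rule power_series_holomorphic)
  show "(\<lambda>n. coord (coord (T (single (to_disc z) (single 0 1))) (to_disc z)) n * (w - 0) ^ n)
      sums char_at z w T" if "w \<in> ball 0 1" for w
    using point_sum_summable(2)[OF that] by (simp add: char_at_def point_sum_def summable_sums)
qed

lemma char_at_zero_diff: "char_at z 0 (S - T) = char_at z 0 S - char_at z 0 T"
  by (simp add: char_at_def blinfun.diff_left bounded_linear.linear bounded_linear_point_sum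
      linear_diff)

text \<open>At \<open>w = 0\<close> a single coordinate is read off. The bound is uniform in
  \<open>z\<close>, so norm limits of operators become uniform limits of functions of
  \<open>z\<close>.\<close>

lemma norm_char_at_zero: "cmod (char_at z 0 T) \<le> norm T"
proof -
  have "cmod (char_at z 0 T) \<le> norm (T (single (to_disc z) (single 0 1)))"
    unfolding char_at_def point_sum_zero by (rule norm_coord_coord_le)
  also have "\<dots> \<le> norm T * norm (single (to_disc z) (single (0::nat) (1::complex)))"
    by (rule norm_blinfun)
  finally show ?thesis
    by (simp add: norm_single)
qed

context
  fixes \<eta>
  assumes \<eta>: "disc_map \<eta>"
begin

lemma point_sum_mult:
  assumes z: "z \<in> cball 0 1" "w \<in> ball 0 1" "w = 0 \<or> \<eta> z = z" and f: "f \<in> disc_algebra"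
  shows "point_sum z w (mult_op \<eta> f \<xi>) = f z * point_sum z w \<xi>"
proof -
  \<comment> \<open>For \<open>w = 0\<close> only \<open>n = 0\<close> contributes, as
    \<open>0 ^ 0 = 1\<close>; otherwise the orbit of \<open>z\<close> is constant.\<close>
  have fw: "f ((\<eta> ^^ n) z) * w ^ n = f z * w ^ n" for n
  proof (cases "w = 0")
    case True
    then show ?thesis
      by (cases n) auto
  next
    case False
    then have "\<eta> z = z"
      using z by blast
    then have "(\<eta> ^^ n) z = z"
      by (induction n) auto
    then show ?thesis
      by simp
  qed
  have eq: "coord (coord (mult_op \<eta> f \<xi>) (to_disc z)) n * w ^ n =
      f z * (coord (coord \<xi> (to_disc z)) n * w ^ n)" for n
  proof -
    have "coord (coord (mult_op \<eta> f \<xi>) (to_disc z)) n * w ^ n =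
        coord (coord \<xi> (to_disc z)) n * (f ((\<eta> ^^ n) z) * w ^ n)"
      using z(1) f by (simp add: coord_mult_op \<eta> to_disc_inverse)
    then show ?thesis
      unfolding fw by (simp only: ac_simps)
  qed
  show ?thesis
    unfolding point_sum_def eq by (rule suminf_mult[OF point_sum_summable(2)[OF z(2)]])
qed

text \<open>The vector \<open>\<xi>\<close> has to stay arbitrary in the induction: for a product,
  the relation for \<open>S\<close> is applied at \<open>T \<xi>\<close>.\<close>

lemma point_sum_semicrossed:
  assumes z: "z \<in> cball 0 1" "w \<in> ball 0 1" "w = 0 \<or> \<eta> z = z" and "T \<in> semicrossed_product \<eta>"
  shows "point_sum z w (T \<xi>) = char_at z w T * point_sum z w \<xi>"
  using \<eta> assms(4)
proof (induction arbitrary: \<xi> rule: semicrossed_induct)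
  case (mult f)
  then show ?case
    by (simp add: char_at_def point_sum_mult[OF z] point_sum_single)
next
  case shift
  then show ?case
    by (simp add: char_at_shift[OF z(2)] point_sum_shift[OF z(2)])
next
  case (add S T)
  have "char_at z w (S + T) = char_at z w S + char_at z w T"
    by (simp add: char_at_def blinfun.add_left point_sum_add[OF z(2)])
  then show ?case
    by (simp add: add.IH blinfun.add_left point_sum_add[OF z(2)] distrib_right)
next
  case (comp S T)
  have "char_at z w (S o\<^sub>L T) = char_at z w S * char_at z w T"
    using comp.IH(1)[of "T (single (to_disc z) (single 0 1))"] by (simp add: char_at_def)
  then show ?case
    by (simp add: comp.IH)
next
  case (scale c T)
  have "char_at z w (cscale_op c T) = c * char_at z w T"
    by (simp add: char_at_def cscale_op_apply point_sum_cscale[OF z(2)])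
  then show ?case
    by (simp add: scale.IH cscale_op_apply point_sum_cscale[OF z(2)])
next
  case (limit X T)
  note lin = bounded_linear.tendsto[OF bounded_linear_point_sum[OF z(2)]]
  have "(\<lambda>n. point_sum z w (X n \<xi>)) \<longlonglongrightarrow> point_sum z w (T \<xi>)"
    by (intro lin tendsto_intros limit)
  moreover have "(\<lambda>n. char_at z w (X n) * point_sum z w \<xi>) \<longlonglongrightarrow> char_at z w T * point_sum z w \<xi>"
    unfolding char_at_def by (intro lin tendsto_intros limit)
  ultimately show ?case
    unfolding limit.IH by (rule LIMSEQ_unique)
qed

lemma char_at_mult:
  assumes "z \<in> cball 0 1" "w \<in> ball 0 1" "w = 0 \<or> \<eta> z = z" "f \<in> disc_algebra"
  shows "char_at z w (mult_op \<eta> f) = f z"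
  by (simp add: char_at_def point_sum_mult[OF assms] point_sum_single)

lemma character_char_at:
  assumes z: "z \<in> cball 0 1" "w \<in> ball 0 1" "w = 0 \<or> \<eta> z = z"
  shows "character (semicrossed_product \<eta>) (char_at z w)"
  unfolding character_def
proof (intro conjI ballI allI)
  have "char_at z w id_blinfun \<noteq> 0"
    by (simp add: char_at_def point_sum_single)
  then show "\<exists>T\<in>semicrossed_product \<eta>. char_at z w T \<noteq> 0"
    using id_in[OF \<eta>] by blast
  fix T assume T: "T \<in> semicrossed_product \<eta>"
  show "char_at z w (cscale_op c T) = c * char_at z w T" for c
    by (simp add: char_at_def cscale_op_apply point_sum_cscale[OF z(2)])
  fix S assume S: "S \<in> semicrossed_product \<eta>"
  show "char_at z w (S + T) = char_at z w S + char_at z w T"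
    by (simp add: char_at_def blinfun.add_left point_sum_add[OF z(2)])
  show "char_at z w (S o\<^sub>L T) = char_at z w S * char_at z w T"
    using point_sum_semicrossed[OF z S, of "T (single (to_disc z) (single 0 1))"]
    by (simp add: char_at_def)
qed

lemma character_char_at_zero:
  "z \<in> cball 0 1 \<Longrightarrow> character (semicrossed_product \<eta>) (char_at z 0)"
  by (rule character_char_at) auto

lemma char_at_zero_disc_algebra:
  assumes "T \<in> semicrossed_product \<eta>"
  shows "(\<lambda>z. char_at z 0 T) \<in> disc_algebra"
  using \<eta> assms
proof (induction rule: semicrossed_induct)
  case (mult f)
  then show ?case
    by (rule disc_algebra_cong) (simp add: char_at_mult mult)
next
  case shift
  show ?case
    using disc_algebra_const[of 0] by (simp add: char_at_shift)
next
  case (add S T)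
  then show ?case
    by (intro disc_algebra_cong[OF disc_algebra_add[OF add.IH]] characterD(1)[OF character_char_at_zero])
next
  case (comp S T)
  then show ?case
    by (intro disc_algebra_cong[OF disc_algebra_mult[OF comp.IH]] characterD(2)[OF character_char_at_zero])
next
  case (scale c T)
  then show ?case
    by (intro disc_algebra_cong[OF disc_algebra_mult[OF disc_algebra_const[of c] scale.IH]]
        characterD(3)[OF character_char_at_zero])
next
  case (limit X T)
  show ?case
  proof (rule disc_algebra_uniform_limit[OF limit.IH], rule uniform_limitI)
    fix e :: real
    assume "0 < e"
    then have "\<forall>\<^sub>F n in sequentially. dist (X n) T < e"
      using tendstoD limit.hyps by blast
    then show "\<forall>\<^sub>F n in sequentially. \<forall>z\<in>cball 0 1. dist (char_at z 0 (X n)) (char_at z 0 T) < e"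
      by eventually_elim
        (auto simp: dist_norm char_at_zero_diff[symmetric] intro: order_le_less_trans[OF norm_char_at_zero])
  qed
qed

section \<open>Splitting off the part without the shift\<close>

lemma norm_mult_op_char_at_zero:
  assumes "S \<in> semicrossed_product \<eta>" "T \<in> semicrossed_product \<eta>"
  shows "norm (mult_op \<eta> (\<lambda>z. char_at z 0 S) - mult_op \<eta> (\<lambda>z. char_at z 0 T)) \<le> norm (S - T)"
proof -
  have "norm (mult_op \<eta> (\<lambda>z. char_at z 0 (S - T))) \<le> norm (S - T)"
    by (rule norm_mult_op[OF \<eta>]) (auto intro: norm_char_at_zero)
  then show ?thesis
    by (simp add: char_at_zero_diff mult_op_diff \<eta> char_at_zero_disc_algebra assms)
qed

text \<open>Such sums are closed under products because multiplication operators can be moved to the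
  right past the shift. They are closed under limits because the first part depends contractively on
  \<open>T\<close> and the shift is isometric, so that the remainders form a Cauchy
  sequence.\<close>

lemma semicrossed_decomposition:
  assumes "T \<in> semicrossed_product \<eta>"
  obtains S where "S \<in> semicrossed_product \<eta>"
    "T = mult_op \<eta> (\<lambda>z. char_at z 0 T) + (shift_op o\<^sub>L S)"
proof -
  let ?A = "semicrossed_product \<eta>"
  let ?M = "\<lambda>T. mult_op \<eta> (\<lambda>z. char_at z 0 T)"
  note closure = semicrossed_closure[OF \<eta>]
  note M_in = mult_op_in[OF \<eta> char_at_zero_disc_algebra]
  note comp_simps = bounded_bilinear.add_left[OF bounded_bilinear_blinfun_compose]
    bounded_bilinear.add_right[OF bounded_bilinear_blinfun_compose]
  have "\<exists>S\<in>?A. T = ?M T + (shift_op o\<^sub>L S)"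
    using \<eta> assms
  proof (induction rule: semicrossed_induct)
    case (mult f)
    have "?M (mult_op \<eta> f) = mult_op \<eta> f"
      using mult by (intro mult_op_cong[OF \<eta>] char_at_zero_disc_algebra mult_op_in \<eta>)
        (simp_all add: char_at_mult)
    moreover have "shift_op o\<^sub>L 0 = (0 :: orbit_space \<Rightarrow>\<^sub>L orbit_space)"
      by (rule blinfun_eqI) (simp add: blinfun.zero_right)
    ultimately show ?case
      using closure(1) by (metis add.right_neutral)
  next
    case shift
    have "shift_op o\<^sub>L id_blinfun = shift_op"
      by (rule blinfun_eqI) simp
    then show ?case
      using id_in[OF \<eta>] by (intro bexI[of _ id_blinfun]) (simp_all add: char_at_shift mult_op_zero[OF \<eta>])
  next
    case (add S T)
    then obtain S' T' where S': "S' \<in> ?A" "S = ?M S + (shift_op o\<^sub>L S')"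
        and T': "T' \<in> ?A" "T = ?M T + (shift_op o\<^sub>L T')"
      by blast
    have "?M (S + T) = ?M S + ?M T"
      using add(1,2) mult_op_add[OF \<eta>, of "\<lambda>z. char_at z 0 S" "\<lambda>z. char_at z 0 T"]
      by (subst mult_op_cong[OF \<eta>, of _ "\<lambda>z. char_at z 0 S + char_at z 0 T"])
        (auto simp: char_at_zero_disc_algebra closure characterD(1)[OF character_char_at_zero])
    moreover have "S + T = (?M S + ?M T) + ((shift_op o\<^sub>L S') + (shift_op o\<^sub>L T'))"
      by (subst S'(2), subst T'(2)) (simp only: add_ac)
    ultimately have "S + T = ?M (S + T) + (shift_op o\<^sub>L (S' + T'))"
      by (simp only: comp_simps(2))
    then show ?case
      using closure(2) S'(1) T'(1) by blast
  next
    case (comp S T)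
    then obtain S' T' where S': "S' \<in> ?A" "S = ?M S + (shift_op o\<^sub>L S')"
        and T': "T' \<in> ?A" "T = ?M T + (shift_op o\<^sub>L T')"
      by blast
    \<comment> \<open>With \<open>S = f + U S'\<close>, the product is
      \<open>f g + f U T' + U S' T\<close>, and \<open>f U = U (f \<circ> \<eta>)\<close>.\<close>
    let ?R = "(mult_op \<eta> (\<lambda>z. char_at (\<eta> z) 0 S) o\<^sub>L T') + (S' o\<^sub>L T)"
    have "?M (S o\<^sub>L T) = ?M S o\<^sub>L ?M T"
      using comp(1,2) mult_op_mult[OF \<eta>, of "\<lambda>z. char_at z 0 S" "\<lambda>z. char_at z 0 T"]
      by (subst mult_op_cong[OF \<eta>, of _ "\<lambda>z. char_at z 0 S * char_at z 0 T"])
        (auto simp: char_at_zero_disc_algebra closure characterD(2)[OF character_char_at_zero])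
    moreover have "S o\<^sub>L T = (?M S o\<^sub>L ?M T) + ((?M S o\<^sub>L shift_op) o\<^sub>L T') + (shift_op o\<^sub>L (S' o\<^sub>L T))"
    proof -
      have "S o\<^sub>L T = (?M S o\<^sub>L T) + ((shift_op o\<^sub>L S') o\<^sub>L T)"
        by (subst S'(2)) (rule comp_simps(1))
      also have "?M S o\<^sub>L T = (?M S o\<^sub>L ?M T) + (?M S o\<^sub>L (shift_op o\<^sub>L T'))"
        by (subst T'(2)) (rule comp_simps(2))
      finally show ?thesis
        by (simp add: blinfun_compose_assoc)
    qed
    moreover have "?M S o\<^sub>L shift_op = shift_op o\<^sub>L mult_op \<eta> (\<lambda>z. char_at (\<eta> z) 0 S)"
      by (rule mult_op_shift[OF \<eta> char_at_zero_disc_algebra[OF comp(1)]])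
    ultimately have "S o\<^sub>L T = ?M (S o\<^sub>L T) + (shift_op o\<^sub>L ?R)"
      by (simp add: comp_simps(2) blinfun_compose_assoc add.assoc)
    moreover have "?R \<in> ?A"
      using disc_algebra_compose[OF char_at_zero_disc_algebra[OF comp(1)] \<eta>]
      by (intro closure comp S' T' mult_op_in[OF \<eta>])
    ultimately show ?case
      by blast
  next
    case (scale c T)
    then obtain T' where T': "T' \<in> ?A" "T = ?M T + (shift_op o\<^sub>L T')"
      by blast
    have "?M (cscale_op c T) = cscale_op c (?M T)"
      using scale(1) mult_op_scale[OF \<eta>, of "\<lambda>z. char_at z 0 T" c]
      by (subst mult_op_cong[OF \<eta>, of _ "\<lambda>z. c * char_at z 0 T"])
        (auto simp: char_at_zero_disc_algebra closure characterD(3)[OF character_char_at_zero])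
    moreover have "cscale_op c T = cscale_op c (?M T) + cscale_op c (shift_op o\<^sub>L T')"
      by (subst T'(2)) (rule blinfun_eqI, simp add: cscale_op_apply blinfun.add_left cscale_add_right)
    ultimately have "cscale_op c T = ?M (cscale_op c T) + (shift_op o\<^sub>L cscale_op c T')"
      by (simp add: semicrossed_comp_scale[OF \<eta> shift_op_in[OF \<eta>]])
    then show ?case
      using closure(4) T'(1) by blast
  next
    case (limit X T)
    then obtain S where S: "\<And>n. S n \<in> ?A" "\<And>n. X n = ?M (X n) + (shift_op o\<^sub>L S n)"
      by metis
    have US: "shift_op o\<^sub>L S n = X n - ?M (X n)" for n
      using S(2)[of n] by (metis add_diff_cancel_left')
    \<comment> \<open>One copy of the norm accounts for \<open>X n - X m\<close>, the other for the
      difference of the first parts.\<close>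
    have bound: "norm (S n - S m) \<le> 2 * norm (X n - X m)" for n m
    proof -
      have "shift_op o\<^sub>L (S n - S m) = (X n - X m) - (?M (X n) - ?M (X m))"
        by (simp add: bounded_bilinear.diff_right[OF bounded_bilinear_blinfun_compose] US)
      then have "norm (S n - S m) \<le> norm ((X n - X m) - (?M (X n) - ?M (X m)))"
        using norm_shift_op_comp by metis
      also have "\<dots> \<le> norm (X n - X m) + norm (?M (X n) - ?M (X m))"
        by (rule norm_triangle_ineq4)
      also have "\<dots> \<le> 2 * norm (X n - X m)"
        using norm_mult_op_char_at_zero[OF limit.hyps(1) limit.hyps(1)] by simp
      finally show ?thesis .
    qed
    have "Cauchy S"
    proof (rule CauchyI)
      fix e :: real
      assume "0 < e"
      then obtain N where N: "\<And>m n. m \<ge> N \<Longrightarrow> n \<ge> N \<Longrightarrow> norm (X m - X n) < e / 2"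
        using CauchyD[OF LIMSEQ_imp_Cauchy[OF limit.hyps(2)], of "e / 2"] by auto
      have "norm (S m - S n) < e" if "m \<ge> N" "n \<ge> N" for m n
        using bound[of m n] N[OF that] by simp
      then show "\<exists>N. \<forall>m\<ge>N. \<forall>n\<ge>N. norm (S m - S n) < e"
        by blast
    qed
    then obtain L where L: "S \<longlonglongrightarrow> L"
      using Cauchy_convergent convergent_def by blast
    have "L \<in> ?A"
      using closed_sequentially[OF closure(5) S(1) L] .
    moreover have "T = ?M T + (shift_op o\<^sub>L L)"
    proof (rule LIMSEQ_unique[OF limit.hyps(2)])
      have "(\<lambda>n. ?M (X n) - ?M T) \<longlonglongrightarrow> 0"
      proof (rule tendsto_norm_zero_cancel, rule tendsto_sandwich[OF _ _ tendsto_const])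
        show "(\<lambda>n. norm (X n - T)) \<longlonglongrightarrow> 0"
          using limit.hyps(2) LIM_zero tendsto_norm_zero by blast
      qed (auto intro!: always_eventually norm_mult_op_char_at_zero limit.hyps)
      then have "(\<lambda>n. ?M (X n)) \<longlonglongrightarrow> ?M T"
        by (rule LIM_zero_cancel)
      then have "(\<lambda>n. ?M (X n) + (shift_op o\<^sub>L S n)) \<longlonglongrightarrow> ?M T + (shift_op o\<^sub>L L)"
        by (intro tendsto_add bounded_bilinear.tendsto[OF bounded_bilinear_blinfun_compose]
            tendsto_const L)
      then show "X \<longlonglongrightarrow> ?M T + (shift_op o\<^sub>L L)"
        by (simp only: S(2)[symmetric])
    qed
    ultimately show ?case
      by blast
  qed
  then show ?thesis
    using that by blast
qed

end

section \<open>All characters\<close>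

context
  fixes \<eta> \<rho>
  assumes \<eta>: "disc_map \<eta>" and \<rho>: "character (semicrossed_product \<eta>) \<rho>"
begin

lemma semicrossed_character_norm_le: "T \<in> semicrossed_product \<eta> \<Longrightarrow> cmod (\<rho> T) \<le> norm T"
  by (rule character_norm_le[OF semicrossed_algebra[OF \<eta>] id_in[OF \<eta>] \<rho>])

lemma character_diff:
  assumes "S \<in> semicrossed_product \<eta>" "T \<in> semicrossed_product \<eta>"
  shows "\<rho> (S - T) = \<rho> S - \<rho> T"
  using characterD(1)[OF \<rho> _ assms(2), of "S - T"] semicrossed_closure(6)[OF \<eta> assms]
  by (simp add: algebra_simps)

lemma character_shift_le: "cmod (\<rho> shift_op) \<le> 1"
  using semicrossed_character_norm_le[OF shift_op_in[OF \<eta>]] norm_shift_op by linarith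

lemma character_position_le: "cmod (\<rho> (mult_op \<eta> (\<lambda>z. z))) \<le> 1"
proof -
  have "norm (mult_op \<eta> (\<lambda>z. z)) \<le> 1"
    by (rule norm_mult_op[OF \<eta>]) auto
  then show ?thesis
    using semicrossed_character_norm_le[OF mult_op_in[OF \<eta> disc_algebra_id]] by linarith
qed

text \<open>
  The point need not be interior; therefore \<open>f - f y\<close> is divisible by \<open>z - y\<close> in the disc algebra
  only after passing to a dilation of \<open>f\<close>.
\<close>

lemma character_mult_op:
  assumes f: "f \<in> disc_algebra"
  shows "\<rho> (mult_op \<eta> f) = f (\<rho> (mult_op \<eta> (\<lambda>z. z)))"
proof -
  define y where "y = \<rho> (mult_op \<eta> (\<lambda>z. z))"
  have y: "y \<in> cball 0 1"
    using character_position_le by (simp add: y_def)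
  have "cmod (\<rho> (mult_op \<eta> f) - f y) \<le> e" if "0 < e" for e
  proof -
    have "uniformly_continuous_on (cball 0 1) f"
      using f by (intro compact_uniformly_continuous) (auto simp: disc_algebra_def)
    then obtain d where d: "0 < d" "\<And>z w. z \<in> cball 0 1 \<Longrightarrow> w \<in> cball 0 1 \<Longrightarrow> dist w z < d \<Longrightarrow>
        dist (f w) (f z) < e / 2"
      using \<open>0 < e\<close> unfolding uniformly_continuous_on_def by (meson half_gt_zero)
    \<comment> \<open>This choice gives \<open>1 - r < d\<close> and \<open>0 < r < 1\<close>: the
      dilation moves points of the closed disc by less than \<open>d\<close>, and \<open>F\<close>
      is analytic on a disc of radius \<open>1 / r > 1\<close>.\<close>
    define r where "r = 1 - min d 1 / 2"
    have r: "0 < r" "r < 1" "1 - r < d"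
      using d(1) by (auto simp: r_def)
    define F where "F z = f (of_real r * z)" for z
    have rz: "of_real r * z \<in> ball 0 1" if "cmod z < 1 / r" for z
      using that r by (simp add: norm_mult field_simps)
    have near: "cmod (f z - F z) \<le> e / 2" if "z \<in> cball 0 1" for z
    proof -
      have "of_real r * z - z = of_real (r - 1) * z"
        by (simp add: algebra_simps)
      then have "dist (of_real r * z) z = (1 - r) * cmod z"
        using r norm_of_real[of "r - 1", where 'a = complex] by (simp only: dist_norm norm_mult) simp
      also have "\<dots> \<le> 1 - r"
        using that r by (intro mult_left_le) auto
      finally have "dist (of_real r * z) z < d"
        using r by simp
      moreover have "of_real r * z \<in> cball 0 1"
        using that r by (simp add: norm_mult mult_le_one)
      ultimately show ?thesis
        using d(2)[OF that, of "of_real r * z"] by (simp add: F_def dist_norm norm_minus_commute)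
    qed
    have hol: "F holomorphic_on ball 0 (1 / r)"
    proof -
      have "f \<circ> (\<lambda>z. of_real r * z) holomorphic_on ball 0 (1 / r)"
        using f rz by (intro holomorphic_on_compose_gen[of _ _ f "ball 0 1"])
          (auto simp: disc_algebra_def intro!: holomorphic_intros)
      then show ?thesis
        by (simp add: F_def[abs_def] o_def)
    qed
    have sub: "cball 0 1 \<subseteq> ball (0::complex) (1 / r)"
    proof -
      have "1 < 1 / r"
        using r by simp
      then show ?thesis
        by (auto intro: order_le_less_trans)
    qed
    have in_alg: "g \<in> disc_algebra" if "g holomorphic_on ball 0 (1 / r)" for g
      unfolding disc_algebra_def
      by (intro CollectI conjI holomorphic_on_subset[OF that] order_trans[OF ball_subset_cball sub]
          continuous_on_subset[OF holomorphic_on_imp_continuous_on[OF that] sub])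
    have F: "F \<in> disc_algebra"
      by (rule in_alg[OF hol])
    \<comment> \<open>The difference quotient with its singularity removed. Applying
      \<open>\<rho>\<close> to \<open>F = F y + (z - y) G\<close> kills the last term by the choice
      of \<open>y\<close>.\<close>
    define G where "G z = (if z = y then deriv F y else (F z - F y) / (z - y))" for z
    have G: "G \<in> disc_algebra"
      using pole_lemma[OF hol, of y] sub y by (intro in_alg) (auto simp: G_def[abs_def])
    have "F = (\<lambda>z. F y + (z - y) * G z)"
      by (auto simp: G_def)
    then have "mult_op \<eta> F = mult_op \<eta> (\<lambda>z. F y + (z - y) * G z)"
      by simp
    also have "\<dots> = cscale_op (F y) id_blinfun +
        ((mult_op \<eta> (\<lambda>z. z) - cscale_op y id_blinfun) o\<^sub>L mult_op \<eta> G)"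
      using mult_op_add[OF \<eta>, of "\<lambda>_. F y" "\<lambda>z. (z - y) * G z"] mult_op_mult[OF \<eta>, of "\<lambda>z. z - y" G]
        mult_op_diff[OF \<eta>, of "\<lambda>z. z" "\<lambda>_. y"] G
      by (simp add: mult_op_const[OF \<eta>] disc_algebra_const disc_algebra_id disc_algebra_diff
          disc_algebra_mult)
    finally have "\<rho> (mult_op \<eta> F) = F y"
      using G by (simp add: characterD[OF \<rho>] character_diff character_id[OF \<rho> id_in[OF \<eta>]]
          semicrossed_closure[OF \<eta>] id_in[OF \<eta>] mult_op_in[OF \<eta>] disc_algebra_id y_def[symmetric])
    moreover have "cmod (\<rho> (mult_op \<eta> f) - \<rho> (mult_op \<eta> F)) \<le> e / 2"
    proof -
      have "cmod (\<rho> (mult_op \<eta> (\<lambda>z. f z - F z))) \<le> norm (mult_op \<eta> (\<lambda>z. f z - F z))"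
        by (intro semicrossed_character_norm_le mult_op_in \<eta> disc_algebra_diff f F)
      also have "\<dots> \<le> e / 2"
        using near \<open>0 < e\<close> by (intro norm_mult_op \<eta>) auto
      finally show ?thesis
        using f F by (simp add: mult_op_diff[OF \<eta>] character_diff mult_op_in[OF \<eta>])
    qed
    ultimately show ?thesis
      using near[OF y] norm_triangle_ineq[of "\<rho> (mult_op \<eta> f) - F y" "F y - f y"]
      by (simp add: norm_minus_commute)
  qed
  then have "cmod (\<rho> (mult_op \<eta> f) - f y) \<le> 0"
    by (rule field_le_epsilon) simp
  then show ?thesis
    by (simp add: y_def)
qed

text \<open>Apply the character to the relation between the coordinate function and the shift; in
  the complex numbers the factors commute.\<close>

lemma character_shift_fixed:
  "\<rho> shift_op * (\<eta> (\<rho> (mult_op \<eta> (\<lambda>z. z))) - \<rho> (mult_op \<eta> (\<lambda>z. z))) = 0"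
proof -
  have "mult_op \<eta> (\<lambda>z. z) o\<^sub>L shift_op = shift_op o\<^sub>L mult_op \<eta> \<eta>"
    using mult_op_shift[OF \<eta> disc_algebra_id] by simp
  then have "\<rho> (mult_op \<eta> (\<lambda>z. z)) * \<rho> shift_op = \<rho> shift_op * \<rho> (mult_op \<eta> \<eta>)"
    using characterD(2)[OF \<rho>] mult_op_in[OF \<eta>] shift_op_in[OF \<eta>] disc_algebra_id
      disc_map_in_algebra[OF \<eta>] by metis
  then show ?thesis
    using character_mult_op[OF disc_map_in_algebra[OF \<eta>]] by auto
qed

end

text \<open>The position determines the values at all multiplication operators by
  \<open>character_mult_op\<close>; contractivity takes care of limits.\<close>

lemma character_eqI:
  assumes \<eta>: "disc_map \<eta>"
    and \<rho>: "character (semicrossed_product \<eta>) \<rho>" and \<sigma>: "character (semicrossed_product \<eta>) \<sigma>"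
    and eq: "\<rho> (mult_op \<eta> (\<lambda>z. z)) = \<sigma> (mult_op \<eta> (\<lambda>z. z))" "\<rho> shift_op = \<sigma> shift_op"
    and "T \<in> semicrossed_product \<eta>"
  shows "\<rho> T = \<sigma> T"
  using \<eta> assms(6)
proof (induction rule: semicrossed_induct)
  case (limit X T)
  have lim: "(\<lambda>n. \<tau> (X n)) \<longlonglongrightarrow> \<tau> T" if \<tau>: "character (semicrossed_product \<eta>) \<tau>" for \<tau>
  proof (rule LIM_zero_cancel, rule tendsto_norm_zero_cancel,
      rule tendsto_sandwich[OF _ _ tendsto_const])
    show "(\<lambda>n. norm (X n - T)) \<longlonglongrightarrow> 0"
      using limit.hyps(2) LIM_zero tendsto_norm_zero by blast
    show "\<forall>\<^sub>F n in sequentially. cmod (\<tau> (X n) - \<tau> T) \<le> norm (X n - T)"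
      using semicrossed_character_norm_le[OF \<eta> \<tau>] limit.hyps
      by (simp add: character_diff[OF \<eta> \<tau>, symmetric] semicrossed_closure[OF \<eta>])
  qed simp
  show ?case
    using lim[OF \<rho>] lim[OF \<sigma>] unfolding limit.IH by (rule LIMSEQ_unique)
qed (simp_all add: characterD[OF \<rho>] characterD[OF \<sigma>] character_mult_op[OF \<eta> \<rho>]
    character_mult_op[OF \<eta> \<sigma>] eq)

lemma semicrossed_commutative:
  assumes \<eta>: "disc_map \<eta>" and id: "\<And>z. z \<in> cball 0 1 \<Longrightarrow> \<eta> z = z"
    and S: "S \<in> semicrossed_product \<eta>" and T: "T \<in> semicrossed_product \<eta>"
  shows "S o\<^sub>L T = T o\<^sub>L S"
proof -
  note comp_simps = bounded_bilinear.add_left[OF bounded_bilinear_blinfun_compose]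
    bounded_bilinear.add_right[OF bounded_bilinear_blinfun_compose]
  \<comment> \<open>Commuting with the generators implies commuting with everything. It is used
    twice: with a generator as \<open>R\<close>, and then with \<open>S\<close>.\<close>
  have ext: "R o\<^sub>L T = T o\<^sub>L R"
    if R: "R \<in> semicrossed_product \<eta>" "\<And>f. f \<in> disc_algebra \<Longrightarrow> R o\<^sub>L mult_op \<eta> f = mult_op \<eta> f o\<^sub>L R"
      "R o\<^sub>L shift_op = shift_op o\<^sub>L R" and T: "T \<in> semicrossed_product \<eta>" for R T
    using \<eta> T
  proof (induction rule: semicrossed_induct)
    case (comp S T)
    then show ?case
      by (metis blinfun_compose_assoc)
  next
    case (scale c T)
    then show ?case
      by (simp add: semicrossed_comp_scale[OF \<eta> R(1)] cscale_op_comp)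
  next
    case (limit X T)
    have "(\<lambda>n. R o\<^sub>L X n) \<longlonglongrightarrow> (R o\<^sub>L T)" "(\<lambda>n. X n o\<^sub>L R) \<longlonglongrightarrow> (T o\<^sub>L R)"
      by (intro bounded_bilinear.tendsto[OF bounded_bilinear_blinfun_compose] tendsto_const limit)+
    then show ?case
      unfolding limit.IH by (rule LIMSEQ_unique)
  qed (simp_all add: R comp_simps)
  have mm: "mult_op \<eta> f o\<^sub>L mult_op \<eta> g = mult_op \<eta> g o\<^sub>L mult_op \<eta> f"
    if "f \<in> disc_algebra" "g \<in> disc_algebra" for f g
    using that by (simp add: mult_op_mult[OF \<eta>, symmetric] mult.commute)
  have ms: "mult_op \<eta> f o\<^sub>L shift_op = shift_op o\<^sub>L mult_op \<eta> f" if "f \<in> disc_algebra" for f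
    using that mult_op_shift[OF \<eta> that] mult_op_cong[OF \<eta>, of f "\<lambda>z. f (\<eta> z)"] id by simp
  show ?thesis
    by (rule ext[OF S _ _ T]) (rule ext[symmetric]; simp add: S mm ms mult_op_in[OF \<eta>] shift_op_in[OF \<eta>])+
qed

section \<open>Isomorphisms\<close>

text \<open>Having the inverse as a parameter makes the setting symmetric, so that every fact is
  available for both directions through \<open>flip\<close>.\<close>

locale semicrossed_iso =
  fixes \<eta> \<eta>' :: "complex \<Rightarrow> complex" and \<phi> \<psi> :: "(orbit_space \<Rightarrow>\<^sub>L orbit_space) \<Rightarrow> (orbit_space \<Rightarrow>\<^sub>L orbit_space)"
  assumes \<eta>: "disc_map \<eta>" and \<eta>': "disc_map \<eta>'"
    and \<phi>_in: "T \<in> semicrossed_product \<eta> \<Longrightarrow> \<phi> T \<in> semicrossed_product \<eta>'"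
    and \<psi>_in: "T \<in> semicrossed_product \<eta>' \<Longrightarrow> \<psi> T \<in> semicrossed_product \<eta>"
    and \<psi>_\<phi>: "T \<in> semicrossed_product \<eta> \<Longrightarrow> \<psi> (\<phi> T) = T"
    and \<phi>_\<psi>: "T \<in> semicrossed_product \<eta>' \<Longrightarrow> \<phi> (\<psi> T) = T"
    and \<phi>_add: "S \<in> semicrossed_product \<eta> \<Longrightarrow> T \<in> semicrossed_product \<eta> \<Longrightarrow> \<phi> (S + T) = \<phi> S + \<phi> T"
    and \<phi>_comp: "S \<in> semicrossed_product \<eta> \<Longrightarrow> T \<in> semicrossed_product \<eta> \<Longrightarrow> \<phi> (S o\<^sub>L T) = \<phi> S o\<^sub>L \<phi> T"
    and \<phi>_scale: "T \<in> semicrossed_product \<eta> \<Longrightarrow> \<phi> (cscale_op c T) = cscale_op c (\<phi> T)"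
begin

lemma flip: "semicrossed_iso \<eta>' \<eta> \<psi> \<phi>"
proof
  fix S T assume ST: "S \<in> semicrossed_product \<eta>'" "T \<in> semicrossed_product \<eta>'"
  show "\<psi> (S + T) = \<psi> S + \<psi> T"
    using \<phi>_add[OF \<psi>_in \<psi>_in, OF ST] \<psi>_\<phi> ST
    by (metis \<phi>_\<psi> \<psi>_in semicrossed_closure(2)[OF \<eta>])
  show "\<psi> (S o\<^sub>L T) = \<psi> S o\<^sub>L \<psi> T"
    using \<phi>_comp[OF \<psi>_in \<psi>_in, OF ST] \<psi>_\<phi> ST
    by (metis \<phi>_\<psi> \<psi>_in semicrossed_closure(3)[OF \<eta>])
next
  fix c T assume T: "T \<in> semicrossed_product \<eta>'"
  show "\<psi> (cscale_op c T) = cscale_op c (\<psi> T)"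
    using \<phi>_scale[OF \<psi>_in, OF T] \<psi>_\<phi> T
    by (metis \<phi>_\<psi> \<psi>_in semicrossed_closure(4)[OF \<eta>])
qed (simp_all add: \<eta> \<eta>' \<phi>_in \<psi>_in \<psi>_\<phi> \<phi>_\<psi>)

abbreviation "pos \<equiv> mult_op \<eta> (\<lambda>z. z)"
abbreviation "pos' \<equiv> mult_op \<eta>' (\<lambda>z. z)"

lemma pos_in: "pos \<in> semicrossed_product \<eta>" and pos'_in: "pos' \<in> semicrossed_product \<eta>'"
  and U_in: "shift_op \<in> semicrossed_product \<eta>" and U'_in: "shift_op \<in> semicrossed_product \<eta>'"
  using \<eta> \<eta>' by (simp_all add: mult_op_in disc_algebra_id shift_op_in)

section \<open>Characters pulled back along the isomorphism\<close>

lemma character_pull: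
  assumes "character (semicrossed_product \<eta>') \<rho>"
  shows "character (semicrossed_product \<eta>) (\<lambda>T. \<rho> (\<phi> T))"
proof -
  obtain T where "T \<in> semicrossed_product \<eta>'" "\<rho> T \<noteq> 0"
    using assms by (auto simp: character_def)
  then have "\<psi> T \<in> semicrossed_product \<eta>" "\<rho> (\<phi> (\<psi> T)) \<noteq> 0"
    by (simp_all add: \<psi>_in \<phi>_\<psi>)
  then show ?thesis
    using characterD[OF assms] unfolding character_def by (auto simp: \<phi>_in \<phi>_add \<phi>_comp \<phi>_scale)
qed

lemma pull_fixed:
  assumes "character (semicrossed_product \<eta>') \<rho>" "\<rho> (\<phi> shift_op) \<noteq> 0"
  shows "\<eta> (\<rho> (\<phi> pos)) = \<rho> (\<phi> pos)"
  using character_shift_fixed[OF \<eta> character_pull[OF assms(1)]] assms(2) by simp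

lemma pull_inject:
  assumes \<rho>: "character (semicrossed_product \<eta>') \<rho>" and \<sigma>: "character (semicrossed_product \<eta>') \<sigma>"
    and "\<rho> (\<phi> pos) = \<sigma> (\<phi> pos)" "\<rho> (\<phi> shift_op) = \<sigma> (\<phi> shift_op)"
    and T: "T \<in> semicrossed_product \<eta>'"
  shows "\<rho> T = \<sigma> T"
  using character_eqI[OF \<eta> character_pull[OF \<rho>] character_pull[OF \<sigma>] assms(3,4) \<psi>_in[OF T]]
  by (simp add: \<phi>_\<psi> T)

text \<open>The pulled back character agrees with a \<open>char_at\<close> at the position and at
  the shift, hence everywhere. The strict bound places the second argument where the power series
  converges.\<close>

lemma pull_char_at:
  assumes \<rho>: "character (semicrossed_product \<eta>') \<rho>" and lt: "cmod (\<rho> (\<phi> shift_op)) < 1"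
    and T: "T \<in> semicrossed_product \<eta>'"
  shows "\<rho> T = char_at (\<rho> (\<phi> pos)) (\<rho> (\<phi> shift_op)) (\<psi> T)"
proof -
  note pull = character_pull[OF \<rho>]
  let ?p = "\<rho> (\<phi> pos)" and ?u = "\<rho> (\<phi> shift_op)"
  have adm: "?p \<in> cball 0 1" "?u \<in> ball 0 1" "?u = 0 \<or> \<eta> ?p = ?p"
    using character_position_le[OF \<eta> pull] lt pull_fixed[OF \<rho>] by auto
  have "\<rho> (\<phi> (\<psi> T)) = char_at ?p ?u (\<psi> T)"
    using character_eqI[OF \<eta> pull character_char_at[OF \<eta> adm] _ _ \<psi>_in[OF T]]
    by (simp add: char_at_mult[OF \<eta> adm disc_algebra_id] char_at_shift[OF adm(2)])
  then show ?thesis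
    by (simp add: \<phi>_\<psi> T)
qed

lemma pull_le:
  assumes "character (semicrossed_product \<eta>') \<rho>"
  shows "cmod (\<rho> (\<phi> pos)) \<le> 1" "cmod (\<rho> (\<phi> shift_op)) \<le> 1"
  using character_position_le[OF \<eta> character_pull[OF assms]]
    character_shift_le[OF \<eta> character_pull[OF assms]] by simp_all

text \<open>
  The characters of a semicrossed product form a horizontal disc of the \<open>char_at z 0\<close>, together
  with a vertical disc \<open>{char_at z w | w}\<close> through every fixed point \<open>z\<close>. The isomorphism maps each
  of these analytically, hence either into the horizontal disc or into a single vertical one.
\<close>

lemma char_horizontal: "z \<in> cball 0 1 \<Longrightarrow> character (semicrossed_product \<eta>') (char_at z 0)"
  by (rule character_char_at_zero[OF \<eta>'])

lemma char_vertical: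
  "z \<in> cball 0 1 \<Longrightarrow> \<eta>' z = z \<Longrightarrow> w \<in> ball 0 1 \<Longrightarrow> character (semicrossed_product \<eta>') (char_at z w)"
  by (rule character_char_at[OF \<eta>']) auto

lemma char_at_pos:
  "z \<in> cball 0 1 \<Longrightarrow> char_at z 0 pos' = z"
  "z \<in> cball 0 1 \<Longrightarrow> \<eta>' z = z \<Longrightarrow> w \<in> ball 0 1 \<Longrightarrow> char_at z w pos' = z"
  by (simp_all add: char_at_mult[OF \<eta>'] disc_algebra_id)

text \<open>Along the disc, the product of the image of \<open>U\<close> with
  \<open>\<eta> p - p\<close> vanishes, \<open>p\<close> being the position. Writing
  \<open>\<eta> p\<close> as the evaluation at \<open>mult_op \<eta> \<eta>\<close> makes its
  holomorphy independent of where \<open>p\<close> takes its values. If the second factor vanishes,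
  \<open>p\<close> runs through fixed points and is constant.\<close>

lemma vertical_dichotomy:
  assumes z: "z \<in> cball 0 1" "\<eta>' z = z" and nid: "\<not> (\<forall>z\<in>cball 0 1. \<eta> z = z)"
  shows "(\<forall>w\<in>ball 0 1. char_at z w (\<phi> shift_op) = 0) \<or>
    (\<forall>w\<in>ball 0 1. char_at z w (\<phi> pos) = char_at z 0 (\<phi> pos))"
proof -
  note char = char_vertical[OF z]
  have "(\<forall>w\<in>ball 0 1. char_at z w (\<phi> shift_op) = 0) \<or>
      (\<forall>w\<in>ball 0 1. char_at z w (\<phi> (mult_op \<eta> \<eta>)) - char_at z w (\<phi> pos) = 0)"
    using character_shift_fixed[OF \<eta> character_pull[OF char]]
      character_mult_op[OF \<eta> character_pull[OF char] disc_map_in_algebra[OF \<eta>]]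
    by (intro holomorphic_mult_eq_zero holomorphic_intros char_at_holomorphic) simp
  moreover have "char_at z w (\<phi> pos) = char_at z 0 (\<phi> pos)"
    if "\<forall>w\<in>ball 0 1. char_at z w (\<phi> (mult_op \<eta> \<eta>)) - char_at z w (\<phi> pos) = 0" "w \<in> ball 0 1" for w
  proof -
    have "(\<lambda>w. char_at z w (\<phi> pos)) constant_on ball 0 1"
      using that(1) pull_le(1)[OF char]
        character_mult_op[OF \<eta> character_pull[OF char] disc_map_in_algebra[OF \<eta>]]
      by (intro holomorphic_fixed_points_constant[OF \<eta> nid] char_at_holomorphic) simp_all
    then show ?thesis
      using that(2) centre_in_ball[of "0::complex" 1] unfolding constant_on_def
      by (metis zero_less_one)
  qed
  ultimately show ?thesis
    by blast
qed

lemma horizontal_disc_algebra: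
  "(\<lambda>z. char_at z 0 (\<phi> shift_op)) \<in> disc_algebra" "(\<lambda>z. char_at z 0 (\<phi> pos)) \<in> disc_algebra"
  by (simp_all add: char_at_zero_disc_algebra[OF \<eta>'] \<phi>_in pos_in U_in)

text \<open>The argument of \<open>vertical_dichotomy\<close> along the other disc; continuity
  carries the constant position from the interior to the circle.\<close>

lemma horizontal_dichotomy:
  assumes nid: "\<not> (\<forall>z\<in>cball 0 1. \<eta> z = z)" and nz: "\<not> (\<forall>z\<in>cball 0 1. char_at z 0 (\<phi> shift_op) = 0)"
    and z: "z \<in> cball 0 1"
  shows "char_at z 0 (\<phi> pos) = char_at 0 0 (\<phi> pos)"
proof -
  note eval = character_mult_op[OF \<eta> character_pull[OF char_horizontal] disc_map_in_algebra[OF \<eta>]]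
  have "(\<forall>z\<in>cball 0 1. char_at z 0 (\<phi> shift_op) = 0) \<or>
      (\<forall>z\<in>cball 0 1. char_at z 0 (\<phi> (mult_op \<eta> \<eta>)) - char_at z 0 (\<phi> pos) = 0)"
    using character_shift_fixed[OF \<eta> character_pull[OF char_horizontal]] eval
    by (intro disc_algebra_mult_eq_zero disc_algebra_diff char_at_zero_disc_algebra[OF \<eta>'] \<phi>_in
        mult_op_in \<eta> disc_algebra_id disc_map_in_algebra U_in) simp_all
  with nz have "\<forall>z\<in>cball 0 1. char_at z 0 (\<phi> (mult_op \<eta> \<eta>)) - char_at z 0 (\<phi> pos) = 0"
    by blast
  then have "\<eta> (char_at z 0 (\<phi> pos)) = char_at z 0 (\<phi> pos)" if "z \<in> cball 0 1" for z
    using eval[OF that] that by simp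
  then have "(\<lambda>z. char_at z 0 (\<phi> pos)) constant_on ball 0 1"
    using horizontal_disc_algebra(2) pull_le(1)[OF char_horizontal]
    by (intro holomorphic_fixed_points_constant[OF \<eta> nid]) (simp_all add: disc_algebra_def)
  then obtain c where c: "\<And>z. z \<in> ball 0 1 \<Longrightarrow> char_at z 0 (\<phi> pos) = c"
    unfolding constant_on_def by blast
  have "char_at z 0 (\<phi> pos) = c"
    by (rule continuous_zero_cball[OF _ _ z, of "\<lambda>z. char_at z 0 (\<phi> pos)"])
      (use c horizontal_disc_algebra(2) in \<open>simp_all add: disc_algebra_def\<close>)
  then show ?thesis
    using c[of 0] by simp
qed

lemma horizontal_fixed:
  assumes nid: "\<not> (\<forall>z\<in>cball 0 1. \<eta> z = z)" and nz: "\<not> (\<forall>z\<in>cball 0 1. char_at z 0 (\<phi> shift_op) = 0)"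
  shows "\<eta> (char_at 0 0 (\<phi> pos)) = char_at 0 0 (\<phi> pos)" "char_at 0 0 (\<phi> pos) \<in> cball 0 1"
proof -
  obtain z where z: "z \<in> cball 0 1" "char_at z 0 (\<phi> shift_op) \<noteq> 0"
    using nz by blast
  then show "\<eta> (char_at 0 0 (\<phi> pos)) = char_at 0 0 (\<phi> pos)" "char_at 0 0 (\<phi> pos) \<in> cball 0 1"
    using pull_fixed[OF char_horizontal, of z] horizontal_dichotomy[OF assms z(1)]
      pull_le(1)[OF char_horizontal, of z] by simp_all
qed

text \<open>Commutativity is an algebraic invariant. In the target it makes the coordinate function
  commute with the shift, and cancelling the shift leaves \<open>\<eta>'\<close> equal to the
  coordinate function.\<close>

lemma identity_transfer:
  assumes "\<And>z. z \<in> cball 0 1 \<Longrightarrow> \<eta> z = z" "z \<in> cball 0 1"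
  shows "\<eta>' z = z"
proof -
  have "pos' o\<^sub>L shift_op = shift_op o\<^sub>L pos'"
    using semicrossed_commutative[OF \<eta> assms(1) \<psi>_in[OF pos'_in] \<psi>_in[OF U'_in]]
      \<phi>_comp[OF \<psi>_in[OF pos'_in] \<psi>_in[OF U'_in]] \<phi>_comp[OF \<psi>_in[OF U'_in] \<psi>_in[OF pos'_in]]
    by (simp add: \<phi>_\<psi> pos'_in U'_in)
  then have "shift_op o\<^sub>L mult_op \<eta>' \<eta>' = shift_op o\<^sub>L pos'"
    using mult_op_shift[OF \<eta>' disc_algebra_id] by simp
  then have "mult_op \<eta>' \<eta>' = pos'"
    by (rule shift_op_cancel)
  then show ?thesis
    using char_at_mult[OF \<eta>' assms(2), of 0 \<eta>'] char_at_pos(1)[OF assms(2)]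
    by (simp add: disc_map_in_algebra[OF \<eta>'])
qed

lemma horizontal_inverse:
  assumes "\<forall>z\<in>cball 0 1. char_at z 0 (\<phi> shift_op) = 0" "z \<in> cball 0 1"
  shows "char_at (char_at z 0 (\<phi> pos)) 0 (\<psi> pos') = z"
  using pull_char_at[OF char_horizontal[OF assms(2)] _ pos'_in] assms char_at_pos(1)[OF assms(2)] by simp

end

text \<open>Two distinct values rule out a constant. The test points 0 and 1/2 serve because in the
  applications \<open>p\<close> is injective.\<close>

lemma holomorphic_strict_bound:
  assumes "p holomorphic_on ball 0 1" "\<And>w. w \<in> ball 0 1 \<Longrightarrow> cmod (p w) \<le> 1"
    and "p 0 \<noteq> p (1 / 2)" "w \<in> ball 0 1"
  shows "cmod (p w) < 1"
proof -
  have "\<not> p constant_on ball 0 1"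
  proof
    assume "p constant_on ball 0 1"
    then obtain c where "\<And>x. x \<in> ball 0 1 \<Longrightarrow> p x = c"
      unfolding constant_on_def by blast
    then have "p 0 = c" "p (1 / 2) = c"
      by simp_all
    then show False
      using assms(3) by simp
  qed
  then show ?thesis
    using holomorphic_bounded_not_constant(2)[OF assms(1,2)] assms(4) by force
qed

section \<open>Exchange of the horizontal disc with a vertical one\<close>

context semicrossed_iso
begin

interpretation inv: semicrossed_iso \<eta>' \<eta> \<psi> \<phi>
  by (rule flip)

text \<open>Otherwise the inverse would send the horizontal disc to one single position, although by
  \<open>horizontal_inverse\<close> it recovers every \<open>z\<close>.\<close>

lemma horizontal_zero_flip:
  assumes nid: "\<not> (\<forall>z\<in>cball 0 1. \<eta>' z = z)"
    and zero: "\<forall>z\<in>cball 0 1. char_at z 0 (\<phi> shift_op) = 0"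
  shows "\<forall>z\<in>cball 0 1. char_at z 0 (\<psi> shift_op) = 0"
proof (rule ccontr)
  assume nz: "\<not> ?thesis"
  have "char_at 0 0 (\<psi> pos') = z" if z: "z \<in> cball 0 1" for z
  proof -
    have "char_at z 0 (\<phi> pos) \<in> cball 0 1"
      using pull_le(1)[OF char_horizontal[OF z]] by simp
    from inv.horizontal_dichotomy[OF nid nz this] show ?thesis
      using horizontal_inverse[OF zero z] by simp
  qed
  from this[of 0] this[of 1] show False
    by simp
qed

text \<open>
  If the horizontal discs do not correspond to each other, each of them is mapped into a vertical
  disc, over \<open>char_at 0 0 (\<phi> pos)\<close> and over \<open>char_at 0 0 (\<psi> pos')\<close>, respectively.
\<close>

lemma vertical_to_horizontal:
  assumes nid: "\<not> (\<forall>z\<in>cball 0 1. \<eta> z = z)" and nid': "\<not> (\<forall>z\<in>cball 0 1. \<eta>' z = z)"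
    and nz: "\<not> (\<forall>z\<in>cball 0 1. char_at z 0 (\<phi> shift_op) = 0)"
    and nz': "\<not> (\<forall>z\<in>cball 0 1. char_at z 0 (\<psi> shift_op) = 0)"
    and w: "w \<in> ball 0 1"
  shows "char_at (char_at 0 0 (\<phi> pos)) w (\<psi> shift_op) = 0"
proof (rule ccontr)
  assume "char_at (char_at 0 0 (\<phi> pos)) w (\<psi> shift_op) \<noteq> 0"
  \<comment> \<open>One nonzero value decides the dichotomy for the whole vertical disc; its centre
    belongs to the horizontal disc, which identifies the constant.\<close>
  then have const: "char_at (char_at 0 0 (\<phi> pos)) w (\<psi> pos') = char_at 0 0 (\<psi> pos')"
    if "w \<in> ball 0 1" for w
    using inv.vertical_dichotomy[OF horizontal_fixed(2,1)[OF nid nz] nid'] w that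
      inv.horizontal_dichotomy[OF nid' nz' horizontal_fixed(2)[OF nid nz]] by metis
  have inj: "z = x" if "z \<in> cball 0 1" "x \<in> cball 0 1"
    "char_at z 0 (\<phi> shift_op) = char_at x 0 (\<phi> shift_op)" for z x
    using pull_inject[OF char_horizontal[OF that(1)] char_horizontal[OF that(2)] _ that(3) pos'_in]
      horizontal_dichotomy[OF nid nz] char_at_pos(1) that by metis
  have "x = char_at 0 0 (\<psi> pos')" if x: "x \<in> ball 0 1" for x
  proof -
    have x': "x \<in> cball 0 1"
      using x by simp
    have lt: "cmod (char_at x 0 (\<phi> shift_op)) < 1"
      using horizontal_disc_algebra(1) pull_le(2)[OF char_horizontal] inj[of 0 "1 / 2"] x
      by (intro holomorphic_strict_bound[of "\<lambda>x. char_at x 0 (\<phi> shift_op)"])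
        (auto simp: disc_algebra_def)
    \<comment> \<open>The character at \<open>x\<close> is sent into the vertical disc, and its
      position \<open>x\<close> is recovered there. As the recovered position is constant along that
      disc, all interior points would coincide.\<close>
    have "x = char_at (char_at x 0 (\<phi> pos)) (char_at x 0 (\<phi> shift_op)) (\<psi> pos')"
      using pull_char_at[OF char_horizontal[OF x'] lt pos'_in] char_at_pos(1)[OF x'] by simp
    also have "\<dots> = char_at 0 0 (\<psi> pos')"
      using horizontal_dichotomy[OF nid nz x'] const lt by simp
    finally show ?thesis .
  qed
  from this[of 0] this[of "1 / 2"] show False
    by simp
qed

text \<open>Suppose the discs are exchanged. If \<open>x\<close> lies on the circle, the centre of
  an injectively embedded analytic disc is sent to a boundary point, against the open mapping
  theorem. If \<open>x\<close> is interior, there is a second fixed point \<open>y\<close>, and its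
  vertical disc is sent into the one over \<open>x'\<close>, all of whose characters come from
  characters vanishing at \<open>U\<close>.\<close>

lemma horizontal_preserved:
  assumes nid: "\<not> (\<forall>z\<in>cball 0 1. \<eta> z = z)" and nid': "\<not> (\<forall>z\<in>cball 0 1. \<eta>' z = z)"
    and ell: "\<not> elliptic \<eta>"
  shows "\<forall>z\<in>cball 0 1. char_at z 0 (\<phi> shift_op) = 0"
proof (rule ccontr)
  assume nz: "\<not> ?thesis"
  then have nz': "\<not> (\<forall>z\<in>cball 0 1. char_at z 0 (\<psi> shift_op) = 0)"
    using semicrossed_iso.horizontal_zero_flip[OF flip, OF nid] by blast
  define x where "x = char_at 0 0 (\<phi> pos)"
  define x' where "x' = char_at 0 0 (\<psi> pos')"
  have x: "x \<in> cball 0 1" "\<eta> x = x"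
    using horizontal_fixed[OF nid nz] by (simp_all add: x_def)
  have x': "x' \<in> cball 0 1" "\<eta>' x' = x'"
    using inv.horizontal_fixed[OF nid' nz'] by (simp_all add: x'_def)
  have vert: "char_at x w (\<psi> shift_op) = 0" "char_at x' w (\<phi> shift_op) = 0" if "w \<in> ball 0 1" for w
    using vertical_to_horizontal[OF nid nid' nz nz' that]
      semicrossed_iso.vertical_to_horizontal[OF flip, OF nid' nid nz' nz that]
    by (simp_all add: x_def x'_def)
  show False
  proof (cases "cmod x < 1")
    case True
    then have "{w \<in> cball 0 1. \<eta> w = w} \<noteq> {x}"
      using ell by (auto simp: elliptic_def)
    then obtain y where y: "y \<in> cball 0 1" "\<eta> y = y" "y \<noteq> x"
      using x by blast
    have hor: "char_at z 0 (\<psi> pos') = x'" if "z \<in> cball 0 1" for z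
      using inv.horizontal_dichotomy[OF nid' nz' that] by (simp add: x'_def)
    \<comment> \<open>If this were 0, the characters at \<open>(y, 0)\<close> and
      \<open>(x, 0)\<close> would have the same image \<open>(x', 0)\<close>.\<close>
    have "char_at y 0 (\<psi> shift_op) \<noteq> 0"
      using inv.pull_inject[OF inv.char_horizontal[OF y(1)] inv.char_horizontal[OF x(1)] _ _ pos_in]
        hor x(1) y vert(1)[of 0] inv.char_at_pos(1) by auto
    then have const: "char_at y w (\<psi> pos') = x'" if "w \<in> ball 0 1" for w
      using inv.vertical_dichotomy[OF y(1,2) nid'] that hor[OF y(1)] centre_in_ball[of "0::complex" 1]
      by (metis zero_less_one)
    note char = inv.char_vertical[OF y(1,2)]
    have inj: "w = u" if "w \<in> ball 0 1" "u \<in> ball 0 1"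
      "char_at y w (\<psi> shift_op) = char_at y u (\<psi> shift_op)" for w u
      using inv.pull_inject[OF char[OF that(1)] char[OF that(2)] _ that(3) U_in] const that(1,2)
        char_at_shift by metis
    have half: "1 / 2 \<in> ball (0::complex) 1"
      by simp
    have "cmod (char_at y (1 / 2) (\<psi> shift_op)) < 1"
      using inj[of 0 "1 / 2"] inv.pull_le(2)[OF char] half
      by (intro holomorphic_strict_bound[of "\<lambda>w. char_at y w (\<psi> shift_op)"] char_at_holomorphic) auto
    \<comment> \<open>The character at \<open>(y, 1 / 2)\<close> is sent to the open vertical disc
      over \<open>x'\<close>, where the image of \<open>U\<close> vanishes by
      \<open>vert(2)\<close>; its actual value at \<open>U\<close> is 1/2.\<close>
    then have "char_at y (1 / 2) shift_op = 0"
      using inv.pull_char_at[OF char[OF half] _ U_in] const[OF half] vert(2) by simp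
    then show False
      using char_at_shift[OF half] by simp
  next
    case False
    have z0: "0 \<in> ball (0::complex) 1"
      by simp
    note char = char_vertical[OF x']
    have "char_at x' 0 (\<phi> pos) = x"
      using horizontal_dichotomy[OF nid nz x'(1)] by (simp add: x_def)
    \<comment> \<open>The image of \<open>U\<close> vanishes along this disc, so the position alone
      separates its points.\<close>
    moreover have inj: "w = u" if "w \<in> ball 0 1" "u \<in> ball 0 1"
      "char_at x' w (\<phi> pos) = char_at x' u (\<phi> pos)" for w u
      using pull_inject[OF char[OF that(1)] char[OF that(2)] that(3) _ U'_in] vert(2) that(1,2)
        char_at_shift by metis
    have "cmod (char_at x' 0 (\<phi> pos)) < 1"
      using inj[of 0 "1 / 2"] pull_le(1)[OF char] z0
      by (intro holomorphic_strict_bound[of "\<lambda>w. char_at x' w (\<phi> pos)"] char_at_holomorphic) auto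
    ultimately show False
      using False by simp
  qed
qed

text \<open>
  Both algebras are the sums of the disc algebra and of the ideal generated by the shift. Modulo
  the square of this ideal, the relation \<open>f U = U (f \<circ> \<eta>)\<close> turns into the intertwining relation.
\<close>

lemma horizontal_intertwines:
  assumes zero: "\<forall>z\<in>cball 0 1. char_at z 0 (\<phi> shift_op) = 0"
    and zero': "\<forall>z\<in>cball 0 1. char_at z 0 (\<psi> shift_op) = 0"
    and z: "z \<in> cball 0 1"
  shows "char_at (\<eta>' z) 0 (\<phi> pos) = \<eta> (char_at z 0 (\<phi> pos))"
proof -
  let ?k = "\<lambda>z. char_at z 0 (\<phi> pos)"
  \<comment> \<open>When the part without the shift vanishes, only the remainder of the
    decomposition is left.\<close>
  have decomp: "\<exists>S\<in>semicrossed_product \<theta>. T = shift_op o\<^sub>L S"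
    if \<theta>: "disc_map \<theta>" and T: "T \<in> semicrossed_product \<theta>" and
      T0: "\<And>z. z \<in> cball 0 1 \<Longrightarrow> char_at z 0 T = 0" for \<theta> T
  proof -
    obtain S where S: "S \<in> semicrossed_product \<theta>" "T = mult_op \<theta> (\<lambda>z. char_at z 0 T) + (shift_op o\<^sub>L S)"
      using semicrossed_decomposition[OF \<theta> T] by blast
    have "mult_op \<theta> (\<lambda>z. char_at z 0 T) = 0"
      using mult_op_cong[OF \<theta> T0 char_at_zero_disc_algebra[OF \<theta> T]] mult_op_zero[OF \<theta>] by simp
    then show ?thesis
      using S by (metis add_0)
  qed
  obtain S where S: "S \<in> semicrossed_product \<eta>'" "\<phi> shift_op = shift_op o\<^sub>L S"
    using decomp[OF \<eta>' \<phi>_in[OF U_in]] zero by blast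
  obtain R where R: "R \<in> semicrossed_product \<eta>'" "\<phi> pos = mult_op \<eta>' ?k + (shift_op o\<^sub>L R)"
    using semicrossed_decomposition[OF \<eta>' \<phi>_in[OF pos_in]] by blast
  note k = char_at_zero_disc_algebra[OF \<eta>' \<phi>_in[OF pos_in]]
  note kc = disc_algebra_compose[OF k \<eta>']
  note \<eta>_in = mult_op_in[OF \<eta> disc_map_in_algebra[OF \<eta>]]
  \<comment> \<open>Pulling the shift to the left composes \<open>?k\<close> with
    \<open>\<eta>'\<close>. The other term keeps a shift on its right, which the horizontal
    characters kill.\<close>
  have shifted: "\<phi> pos o\<^sub>L shift_op =
      shift_op o\<^sub>L (mult_op \<eta>' (\<lambda>z. ?k (\<eta>' z)) + (R o\<^sub>L shift_op))"
    using arg_cong[OF R(2), of "\<lambda>T. T o\<^sub>L shift_op"] mult_op_shift[OF \<eta>' k]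
    by (simp add: bounded_bilinear.add_left[OF bounded_bilinear_blinfun_compose]
        bounded_bilinear.add_right[OF bounded_bilinear_blinfun_compose] blinfun_compose_assoc)
  have "\<phi> pos o\<^sub>L \<phi> shift_op = \<phi> shift_op o\<^sub>L \<phi> (mult_op \<eta> \<eta>)"
    using mult_op_shift[OF \<eta> disc_algebra_id] \<phi>_comp[OF pos_in U_in] \<phi>_comp[OF U_in \<eta>_in] by simp
  then have "(\<phi> pos o\<^sub>L shift_op) o\<^sub>L S = shift_op o\<^sub>L (S o\<^sub>L \<phi> (mult_op \<eta> \<eta>))"
    by (simp add: S(2) blinfun_compose_assoc)
  then have eq: "(mult_op \<eta>' (\<lambda>z. ?k (\<eta>' z)) + (R o\<^sub>L shift_op)) o\<^sub>L S = S o\<^sub>L \<phi> (mult_op \<eta> \<eta>)"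
    unfolding shifted blinfun_compose_assoc by (rule shift_op_cancel)
  have prod: "char_at z 0 S * (?k (\<eta>' z) - \<eta> (?k z)) = 0" if z: "z \<in> cball 0 1" for z
  proof -
    note char = char_horizontal[OF z]
    have "char_at z 0 ((mult_op \<eta>' (\<lambda>z. ?k (\<eta>' z)) + (R o\<^sub>L shift_op)) o\<^sub>L S) =
        ?k (\<eta>' z) * char_at z 0 S"
      using char_at_mult[OF \<eta>' z, of 0 "\<lambda>z. ?k (\<eta>' z)"] kc
      by (simp add: characterD[OF char] semicrossed_closure[OF \<eta>'] mult_op_in[OF \<eta>'] R(1) S(1)
          U'_in char_at_shift)
    moreover have "char_at z 0 (S o\<^sub>L \<phi> (mult_op \<eta> \<eta>)) = char_at z 0 S * \<eta> (?k z)"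
      using character_mult_op[OF \<eta> character_pull[OF char] disc_map_in_algebra[OF \<eta>]]
      by (simp add: characterD[OF char] S(1) \<phi>_in[OF \<eta>_in])
    ultimately show ?thesis
      using eq by (auto simp: mult.commute)
  qed
  \<comment> \<open>Otherwise \<open>\<phi> U\<close> would be divisible by the square of
    \<open>U\<close>. As \<open>\<psi> U\<close> is divisible by \<open>U\<close>, so would be
    \<open>U\<close> itself by the square of \<open>U\<close>, and cancelling one factor would put
    the identity into the kernel of a character.\<close>
  have "\<not> (\<forall>z\<in>cball 0 1. char_at z 0 S = 0)"
  proof
    assume "\<forall>z\<in>cball 0 1. char_at z 0 S = 0"
    then obtain S' where S': "S' \<in> semicrossed_product \<eta>'" "S = shift_op o\<^sub>L S'"
      using decomp[OF \<eta>' S(1)] by blast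
    obtain Q where Q: "Q \<in> semicrossed_product \<eta>" "\<psi> shift_op = shift_op o\<^sub>L Q"
      using decomp[OF \<eta> \<psi>_in[OF U'_in]] zero' by blast
    have "shift_op = \<phi> (shift_op o\<^sub>L Q)"
      using \<phi>_\<psi>[OF U'_in] Q(2) by simp
    also have "\<dots> = shift_op o\<^sub>L (shift_op o\<^sub>L (S' o\<^sub>L \<phi> Q))"
      by (simp add: \<phi>_comp[OF U_in Q(1)] S(2) S'(2) blinfun_compose_assoc)
    finally have "shift_op o\<^sub>L id_blinfun = shift_op o\<^sub>L (shift_op o\<^sub>L (S' o\<^sub>L \<phi> Q))"
      by (simp add: blinfun_eqI)
    then have "id_blinfun = shift_op o\<^sub>L (S' o\<^sub>L \<phi> Q)"
      by (rule shift_op_cancel)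
    moreover have "char_at 0 0 (shift_op o\<^sub>L (S' o\<^sub>L \<phi> Q)) = 0"
      using characterD(2)[OF char_horizontal U'_in] semicrossed_closure(3)[OF \<eta>' S'(1) \<phi>_in[OF Q(1)]]
      by (simp add: char_at_shift)
    ultimately show False
      using character_id[OF char_horizontal id_in[OF \<eta>'], of 0] by simp
  qed
  moreover have "(\<forall>z\<in>cball 0 1. char_at z 0 S = 0) \<or> (\<forall>z\<in>cball 0 1. ?k (\<eta>' z) - \<eta> (?k z) = 0)"
  proof (rule disc_algebra_mult_eq_zero[OF char_at_zero_disc_algebra[OF \<eta>' S(1)] _ prod])
    have "(\<lambda>z. \<eta> (?k z)) \<in> disc_algebra"
    proof (rule disc_algebra_compose[OF disc_map_in_algebra[OF \<eta>]])
      show "disc_map ?k"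
        using k pull_le(1)[OF char_horizontal] by (auto simp: disc_map_def)
    qed
    then show "(\<lambda>z. ?k (\<eta>' z) - \<eta> (?k z)) \<in> disc_algebra"
      by (rule disc_algebra_diff[OF kc])
  qed
  ultimately show ?thesis
    using z by auto
qed

lemma conjugate:
  assumes "\<not> elliptic \<eta>"
  shows "\<exists>\<gamma> \<gamma>'. homeomorphism (cball 0 1) (cball 0 1) \<gamma> \<gamma>' \<and> \<gamma> holomorphic_on ball 0 1 \<and>
    (\<forall>z\<in>cball 0 1. \<gamma> (\<eta> z) = \<eta>' (\<gamma> z))"
proof (cases "\<forall>z\<in>cball 0 1. \<eta> z = z")
  case True
  then have "\<forall>z\<in>cball 0 1. \<eta>' z = z"
    using identity_transfer by blast
  with True show ?thesis
    by (intro exI[of _ "\<lambda>z. z"]) (auto simp: homeomorphism_def)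
next
  case nid: False
  then have nid': "\<not> (\<forall>z\<in>cball 0 1. \<eta>' z = z)"
    using inv.identity_transfer by blast
  note zero = horizontal_preserved[OF nid nid' assms]
  note zero' = horizontal_zero_flip[OF nid' zero]
  \<comment> \<open>Characters are pulled back, so the map from the disc of \<open>\<eta>\<close> to
    that of \<open>\<eta>'\<close> comes from \<open>\<psi>\<close>.\<close>
  let ?\<gamma> = "\<lambda>z. char_at z 0 (\<psi> pos')" and ?\<gamma>' = "\<lambda>z. char_at z 0 (\<phi> pos)"
  have "homeomorphism (cball 0 1) (cball 0 1) ?\<gamma> ?\<gamma>'"
  proof (rule homeomorphismI)
    show "continuous_on (cball 0 1) ?\<gamma>" "continuous_on (cball 0 1) ?\<gamma>'"
      using horizontal_disc_algebra(2) inv.horizontal_disc_algebra(2) by (simp_all add: disc_algebra_def)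
    show "?\<gamma>' (?\<gamma> z) = z" if "z \<in> cball 0 1" for z
      using inv.horizontal_inverse[OF zero' that] .
    show "?\<gamma> (?\<gamma>' z) = z" if "z \<in> cball 0 1" for z
      using horizontal_inverse[OF zero that] .
  qed (use pull_le(1)[OF char_horizontal] inv.pull_le(1)[OF inv.char_horizontal] in auto)
  moreover have "?\<gamma> holomorphic_on ball 0 1"
    using inv.horizontal_disc_algebra(2) by (simp add: disc_algebra_def)
  moreover have "\<forall>z\<in>cball 0 1. ?\<gamma> (\<eta> z) = \<eta>' (?\<gamma> z)"
    using semicrossed_iso.horizontal_intertwines[OF flip, OF zero' zero] by blast
  ultimately show ?thesis
    by blast
qed

end

lemma isomorphic_imp_iso:
  assumes "disc_map \<eta>" "disc_map \<eta>'"
    and "isomorphic_algebras (semicrossed_product \<eta>) (semicrossed_product \<eta>')"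
  obtains \<phi> \<psi> where "semicrossed_iso \<eta> \<eta>' \<phi> \<psi>"
proof -
  obtain \<phi> where \<phi>: "bij_betw \<phi> (semicrossed_product \<eta>) (semicrossed_product \<eta>')"
    "\<forall>S\<in>semicrossed_product \<eta>. \<forall>T\<in>semicrossed_product \<eta>.
      \<phi> (S + T) = \<phi> S + \<phi> T \<and> \<phi> (S o\<^sub>L T) = \<phi> S o\<^sub>L \<phi> T"
    "\<forall>c. \<forall>T\<in>semicrossed_product \<eta>. \<phi> (cscale_op c T) = cscale_op c (\<phi> T)"
    using assms(3) unfolding isomorphic_algebras_def by blast
  have "semicrossed_iso \<eta> \<eta>' \<phi> (inv_into (semicrossed_product \<eta>) \<phi>)"
    using assms \<phi> bij_betw_inv_into[OF \<phi>(1)] bij_betw_inv_into_left[OF \<phi>(1)] bij_betw_inv_into_right[OF \<phi>(1)]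
    by unfold_locales (auto simp: bij_betwE)
  then show ?thesis
    using that by blast
qed

section \<open>Conjugations\<close>

text \<open>All summands are copies of one space, so a bijection of the index set acts as a unitary
  permutation of them.\<close>

definition relabel :: "('i \<Rightarrow> 'i) \<Rightarrow> ('i, 'a::real_inner) hilbert_sum \<Rightarrow>\<^sub>L ('i, 'a) hilbert_sum"
  where "relabel \<sigma> = Blinfun (\<lambda>\<xi>. of_coords (\<lambda>i. coord \<xi> (\<sigma> i)))"

lemma coord_relabel:
  fixes \<xi> :: "('i, 'a::real_inner) hilbert_sum"
  assumes "bij \<sigma>"
  shows "coord (relabel \<sigma> \<xi>) i = coord \<xi> (\<sigma> i)"
proof -
  have hs: "((\<lambda>i. (norm (coord \<zeta> (\<sigma> i)))\<^sup>2) has_sum (norm \<zeta>)\<^sup>2) UNIV"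
    for \<zeta> :: "('i, 'a) hilbert_sum"
  proof -
    have "((\<lambda>i. (norm (coord \<zeta> i))\<^sup>2) has_sum (norm \<zeta>)\<^sup>2) UNIV"
      unfolding norm_hilbert_sum_square by (rule has_sum_infsum[OF coord_summable])
    then show ?thesis
      using has_sum_reindex_bij_betw[OF assms, of "\<lambda>i. (norm (coord \<zeta> i))\<^sup>2"] by simp
  qed
  have c: "coord (of_coords (\<lambda>i. coord \<zeta> (\<sigma> i))) = (\<lambda>i. coord \<zeta> (\<sigma> i))"
    for \<zeta> :: "('i, 'a) hilbert_sum"
    using has_sum_imp_summable[OF hs] by (subst of_coords_inverse) auto
  have "bounded_linear (\<lambda>\<zeta> :: ('i, 'a) hilbert_sum. of_coords (\<lambda>i. coord \<zeta> (\<sigma> i)))"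
  proof (rule bounded_linear_intro[where K = 1])
    fix \<zeta> \<zeta>' :: "('i, 'a) hilbert_sum" and r
    show "of_coords (\<lambda>i. coord (\<zeta> + \<zeta>') (\<sigma> i)) =
        of_coords (\<lambda>i. coord \<zeta> (\<sigma> i)) + of_coords (\<lambda>i. coord \<zeta>' (\<sigma> i))"
      "of_coords (\<lambda>i. coord (r *\<^sub>R \<zeta>) (\<sigma> i)) = r *\<^sub>R of_coords (\<lambda>i. coord \<zeta> (\<sigma> i))"
      by (rule coord_inject[THEN iffD1], rule ext, simp only: c,
          simp add: plus_hilbert_sum.rep_eq scaleR_hilbert_sum.rep_eq c)+
    have "(norm (of_coords (\<lambda>i. coord \<zeta> (\<sigma> i))))\<^sup>2 = (norm \<zeta>)\<^sup>2"
      using infsumI[OF hs] by (subst norm_hilbert_sum_square) (simp add: c)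
    then show "norm (of_coords (\<lambda>i. coord \<zeta> (\<sigma> i))) \<le> norm \<zeta> * 1"
      by simp
  qed
  then show ?thesis
    by (simp add: relabel_def bounded_linear_Blinfun_apply c)
qed

context
  fixes \<sigma> \<tau> :: "disc \<Rightarrow> disc"
  assumes \<sigma>\<tau>: "\<And>x. \<sigma> (\<tau> x) = x" and \<tau>\<sigma>: "\<And>x. \<tau> (\<sigma> x) = x"
begin

lemma bij_relabeling: "bij \<sigma>" "bij \<tau>"
  unfolding bij_def inj_def surj_def by (metis \<sigma>\<tau> \<tau>\<sigma>)+

lemma relabel_inverse: "relabel \<sigma> o\<^sub>L relabel \<tau> = (id_blinfun :: orbit_space \<Rightarrow>\<^sub>L orbit_space)"
  by (intro orbit_op_eqI) (simp add: coord_relabel bij_relabeling \<tau>\<sigma>)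

end

section \<open>Transport of operators by a permutation of the summands\<close>

definition conjugate_op ::
    "(disc \<Rightarrow> disc) \<Rightarrow> (disc \<Rightarrow> disc) \<Rightarrow> (orbit_space \<Rightarrow>\<^sub>L orbit_space) \<Rightarrow> orbit_space \<Rightarrow>\<^sub>L orbit_space"
  where "conjugate_op \<sigma> \<tau> T = relabel \<sigma> o\<^sub>L T o\<^sub>L relabel \<tau>"

context
  fixes \<sigma> \<tau> :: "disc \<Rightarrow> disc"
  assumes \<sigma>\<tau>: "\<And>x. \<sigma> (\<tau> x) = x" and \<tau>\<sigma>: "\<And>x. \<tau> (\<sigma> x) = x"
begin

lemma coord_conjugate_op:
  "coord (conjugate_op \<sigma> \<tau> T \<xi>) x = coord (T (relabel \<tau> \<xi>)) (\<sigma> x)"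
  by (simp add: conjugate_op_def coord_relabel bij_relabeling[OF \<sigma>\<tau> \<tau>\<sigma>])

lemma conjugate_op_add: "conjugate_op \<sigma> \<tau> (S + T) = conjugate_op \<sigma> \<tau> S + conjugate_op \<sigma> \<tau> T"
  by (rule blinfun_eqI) (simp add: conjugate_op_def blinfun.add_left blinfun.add_right)

lemma conjugate_op_scale: "conjugate_op \<sigma> \<tau> (cscale_op c T) = cscale_op c (conjugate_op \<sigma> \<tau> T)"
  by (intro orbit_op_eqI)
    (simp add: coord_conjugate_op cscale_op_apply coord_cscale)

lemma conjugate_op_comp: "conjugate_op \<sigma> \<tau> (S o\<^sub>L T) = conjugate_op \<sigma> \<tau> S o\<^sub>L conjugate_op \<sigma> \<tau> T"
proof -
  have "relabel \<tau> (relabel \<sigma> \<xi>) = \<xi>" for \<xi> :: orbit_space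
    using relabel_inverse[OF \<tau>\<sigma> \<sigma>\<tau>] by (metis blinfun_apply_blinfun_compose id_blinfun.rep_eq id_apply)
  then show ?thesis
    by (intro blinfun_eqI) (simp add: conjugate_op_def)
qed

lemma conjugate_op_inverse: "conjugate_op \<sigma> \<tau> (conjugate_op \<tau> \<sigma> T) = T"
proof -
  have "relabel \<sigma> (relabel \<tau> \<xi>) = \<xi>" for \<xi> :: orbit_space
    using relabel_inverse[OF \<sigma>\<tau> \<tau>\<sigma>] by (metis blinfun_apply_blinfun_compose id_blinfun.rep_eq id_apply)
  then show ?thesis
    by (intro blinfun_eqI) (simp add: conjugate_op_def)
qed

text \<open>The map \<gamma> carries the \<eta>-orbit of \<open>x\<close> to the
  \<open>\<eta>'\<close>-orbit of its image. Multiplication by \<open>f\<close> thus becomes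
  multiplication by \<open>f \<circ> \<gamma>\<close>, while the shift acts in the same way on all
  summands and is unchanged.\<close>

lemma conjugate_op_semicrossed:
  assumes \<eta>: "disc_map \<eta>" and \<eta>': "disc_map \<eta>'" and \<gamma>: "disc_map \<gamma>"
    and conj: "\<And>z. z \<in> cball 0 1 \<Longrightarrow> \<gamma> (\<eta> z) = \<eta>' (\<gamma> z)"
    and \<sigma>: "\<And>x. of_disc (\<sigma> x) = \<gamma> (of_disc x)"
    and T: "T \<in> semicrossed_product \<eta>'"
  shows "conjugate_op \<sigma> \<tau> T \<in> semicrossed_product \<eta>"
  using \<eta>' T
proof (induction rule: semicrossed_induct)
  case (mult f)
  have iter: "(\<eta>' ^^ n) (\<gamma> (of_disc x)) = \<gamma> ((\<eta> ^^ n) (of_disc x))" for n x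
  proof (induction n)
    case (Suc n)
    then show ?case
      using conj[OF funpow_disc_map[OF \<eta>, of n x]] by simp
  qed simp
  have "conjugate_op \<sigma> \<tau> (mult_op \<eta>' f) = mult_op \<eta> (\<lambda>z. f (\<gamma> z))"
    using mult disc_algebra_compose[OF mult \<gamma>]
    by (intro orbit_op_eqI) (simp add: coord_conjugate_op coord_mult_op \<eta> \<eta>' \<sigma> iter
        coord_relabel bij_relabeling[OF \<sigma>\<tau> \<tau>\<sigma>] \<tau>\<sigma>)
  then show ?case
    using mult_op_in[OF \<eta> disc_algebra_compose[OF mult \<gamma>]] by simp
next
  case shift
  have "conjugate_op \<sigma> \<tau> shift_op = shift_op"
    by (intro orbit_op_eqI) (simp add: coord_conjugate_op coord_shift_op
        coord_relabel bij_relabeling[OF \<sigma>\<tau> \<tau>\<sigma>] \<tau>\<sigma>)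
  then show ?case
    using shift_op_in[OF \<eta>] by simp
next
  case (limit X T)
  have "(\<lambda>n. conjugate_op \<sigma> \<tau> (X n)) \<longlonglongrightarrow> conjugate_op \<sigma> \<tau> T"
    unfolding conjugate_op_def
    by (intro bounded_bilinear.tendsto[OF bounded_bilinear_blinfun_compose] tendsto_const limit)
  with limit.IH show ?case
    by (rule closed_sequentially[OF semicrossed_closure(5)[OF \<eta>]])
qed (simp_all add: conjugate_op_add conjugate_op_comp conjugate_op_scale semicrossed_closure[OF \<eta>])

end

lemma homeomorphism_disc_map:
  assumes hom: "homeomorphism (cball 0 1) (cball 0 1) \<gamma> \<gamma>'" and hol: "\<gamma> holomorphic_on ball 0 1"
  shows "disc_map \<gamma>" "disc_map \<gamma>'"
proof -
  have cont: "continuous_on (cball 0 1) \<gamma>" "continuous_on (cball 0 1) \<gamma>'"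
    and img: "\<gamma> ` cball 0 1 = cball 0 1" "\<gamma>' ` cball 0 1 = cball 0 1"
    and inv: "\<And>z. z \<in> cball 0 1 \<Longrightarrow> \<gamma>' (\<gamma> z) = z" "\<And>z. z \<in> cball 0 1 \<Longrightarrow> \<gamma> (\<gamma>' z) = z"
    using hom by (auto simp: homeomorphism_def)
  show "disc_map \<gamma>"
    using cont hol img by (simp add: disc_map_def disc_algebra_def)
  have "inj_on \<gamma>' (cball 0 1)"
    by (metis inj_onI inv(2))
  \<comment> \<open>Analyticity of \<open>\<gamma>'\<close> is still unknown here, so openness comes
    from invariance of domain. It ensures that \<gamma> maps the open disc onto a set containing the
    open disc, where the analytic inverse is defined.\<close>
  then have "open (\<gamma>' ` ball 0 1)"
    using cont(2) by (intro invariance_of_domain_ball) auto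
  moreover have "\<gamma>' ` ball 0 1 \<subseteq> cball 0 1"
    using img(2) ball_subset_cball by blast
  ultimately have "\<gamma>' ` ball 0 1 \<subseteq> interior (cball 0 1)"
    by (intro interior_maximal)
  then have sub: "\<gamma>' ` ball 0 1 \<subseteq> ball 0 1"
    by simp
  have inj: "inj_on \<gamma> (ball 0 1)"
    by (metis inj_onI inv(1) ball_subset_cball subsetD)
  obtain g where g: "g holomorphic_on \<gamma> ` ball 0 1" "\<And>z. z \<in> ball 0 1 \<Longrightarrow> g (\<gamma> z) = z"
  proof (rule holomorphic_has_inverse[OF hol open_ball inj])
  qed (rule that)
  have *: "z \<in> \<gamma> ` ball 0 1" "g z = \<gamma>' z" if "z \<in> ball 0 1" for z
  proof -
    have "z = \<gamma> (\<gamma>' z)" "\<gamma>' z \<in> ball 0 1"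
      using that sub inv(2)[of z] by (simp, blast)
    then show "z \<in> \<gamma> ` ball 0 1" "g z = \<gamma>' z"
      using g(2)[of "\<gamma>' z"] by (metis imageI, metis)
  qed
  then have "ball 0 1 \<subseteq> \<gamma> ` ball 0 1"
    by (intro subsetI)
  then have "g holomorphic_on ball 0 1"
    by (rule holomorphic_on_subset[OF g(1)])
  then have "\<gamma>' holomorphic_on ball 0 1"
    using *(2) by (rule holomorphic_transform)
  then show "disc_map \<gamma>'"
    using cont img by (simp add: disc_map_def disc_algebra_def)
qed

lemma conjugate_imp_isomorphic:
  assumes \<eta>: "disc_map \<eta>" and \<eta>': "disc_map \<eta>'"
    and hom: "homeomorphism (cball 0 1) (cball 0 1) \<gamma> \<gamma>'" and hol: "\<gamma> holomorphic_on ball 0 1"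
    and conj: "\<And>z. z \<in> cball 0 1 \<Longrightarrow> \<gamma> (\<eta> z) = \<eta>' (\<gamma> z)"
  shows "isomorphic_algebras (semicrossed_product \<eta>) (semicrossed_product \<eta>')"
proof -
  note dm = homeomorphism_disc_map[OF hom hol]
  have inv: "\<gamma>' (\<gamma> z) = z" "\<gamma> (\<gamma>' z) = z" if "z \<in> cball 0 1" for z
    using hom that by (auto simp: homeomorphism_def)
  have conj': "\<gamma>' (\<eta>' z) = \<eta> (\<gamma>' z)" if "z \<in> cball 0 1" for z
  proof -
    note z' = disc_map_bound[OF dm(2) that]
    have "\<gamma>' (\<gamma> (\<eta> (\<gamma>' z))) = \<eta> (\<gamma>' z)"
      by (rule inv(1)[OF disc_map_bound[OF \<eta> z']])
    then show ?thesis
      using conj[OF z'] inv(2)[OF that] by simp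
  qed
  define \<sigma> where "\<sigma> x = to_disc (\<gamma> (of_disc x))" for x
  define \<tau> where "\<tau> x = to_disc (\<gamma>' (of_disc x))" for x
  have \<sigma>: "of_disc (\<sigma> x) = \<gamma> (of_disc x)" and \<tau>: "of_disc (\<tau> x) = \<gamma>' (of_disc x)" for x
    using disc_map_bound[OF dm(1) of_disc] disc_map_bound[OF dm(2) of_disc]
    by (simp_all add: \<sigma>_def \<tau>_def to_disc_inverse)
  have \<sigma>\<tau>: "\<sigma> (\<tau> x) = x" and \<tau>\<sigma>: "\<tau> (\<sigma> x) = x" for x
    using inv[OF of_disc[of x]] by (simp_all add: of_disc_inject[symmetric] \<sigma> \<tau>)
  show ?thesis
    unfolding isomorphic_algebras_def
  \<comment> \<open>Conjugation along \<open>\<sigma>\<close> leads from the algebra of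
    \<open>\<eta>'\<close> to that of \<eta>; the required direction is its inverse.\<close>
  proof (intro exI[of _ "conjugate_op \<tau> \<sigma>"] conjI ballI allI)
    show "bij_betw (conjugate_op \<tau> \<sigma>) (semicrossed_product \<eta>) (semicrossed_product \<eta>')"
    proof (rule bij_betw_byWitness[where f' = "conjugate_op \<sigma> \<tau>"])
      show "conjugate_op \<tau> \<sigma> ` semicrossed_product \<eta> \<subseteq> semicrossed_product \<eta>'"
        using conjugate_op_semicrossed[OF \<tau>\<sigma> \<sigma>\<tau> \<eta>' \<eta> dm(2) conj' \<tau>] by blast
      show "conjugate_op \<sigma> \<tau> ` semicrossed_product \<eta>' \<subseteq> semicrossed_product \<eta>"
        using conjugate_op_semicrossed[OF \<sigma>\<tau> \<tau>\<sigma> \<eta> \<eta>' dm(1) conj \<sigma>] by blast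
    qed (simp_all add: conjugate_op_inverse \<sigma>\<tau> \<tau>\<sigma>)
  qed (simp_all add: conjugate_op_add conjugate_op_comp conjugate_op_scale \<sigma>\<tau> \<tau>\<sigma>)
qed

theorem corollary5p9:
  fixes \<eta>\<^sub>1 \<eta>\<^sub>2 :: "complex \<Rightarrow> complex"
  assumes "disc_map \<eta>\<^sub>1" and "disc_map \<eta>\<^sub>2" and "\<not> elliptic \<eta>\<^sub>1"
  shows "isomorphic_algebras (semicrossed_product \<eta>\<^sub>1) (semicrossed_product \<eta>\<^sub>2) \<longleftrightarrow>
    (\<exists>\<gamma> \<gamma>'. homeomorphism (cball 0 1) (cball 0 1) \<gamma> \<gamma>' \<and> \<gamma> holomorphic_on ball 0 1 \<and>
      (\<forall>z\<in>cball 0 1. \<gamma> (\<eta>\<^sub>1 z) = \<eta>\<^sub>2 (\<gamma> z)))"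
proof
  assume "isomorphic_algebras (semicrossed_product \<eta>\<^sub>1) (semicrossed_product \<eta>\<^sub>2)"
  then obtain \<phi> \<psi> where "semicrossed_iso \<eta>\<^sub>1 \<eta>\<^sub>2 \<phi> \<psi>"
    using isomorphic_imp_iso[OF assms(1,2)] by blast
  then show "\<exists>\<gamma> \<gamma>'. homeomorphism (cball 0 1) (cball 0 1) \<gamma> \<gamma>' \<and> \<gamma> holomorphic_on ball 0 1 \<and>
      (\<forall>z\<in>cball 0 1. \<gamma> (\<eta>\<^sub>1 z) = \<eta>\<^sub>2 (\<gamma> z))"
    using assms(3) by (rule semicrossed_iso.conjugate)
next
  assume "\<exists>\<gamma> \<gamma>'. homeomorphism (cball 0 1) (cball 0 1) \<gamma> \<gamma>' \<and> \<gamma> holomorphic_on ball 0 1 \<and>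
      (\<forall>z\<in>cball 0 1. \<gamma> (\<eta>\<^sub>1 z) = \<eta>\<^sub>2 (\<gamma> z))"
  then show "isomorphic_algebras (semicrossed_product \<eta>\<^sub>1) (semicrossed_product \<eta>\<^sub>2)"
    using conjugate_imp_isomorphic[OF assms(1,2)] by blast
qed

end
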